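(* Let $n\ge1$, let $F$ be an $n$-perturbation on $H^2(\mathbb{D})$, and let $\mathcal{M}$ be a nonzero closed subspace of $H^2(\mathbb{D})$. Then $\mathcal{M}$ is invariant under $S_n = M_z + F$ if and only if there exist an inner function $\theta \in H^\infty(\mathbb{D})$ and polynomials $p_0,\dots,p_{n-1},q_0,\dots,q_{n-1} \in \mathbb{C}[z]$ such that \[\mathcal{M} = (\mathbb{C}\varphi_0 \oplus \mathbb{C}\varphi_1 \oplus \cdots \oplus \mathbb{C}\varphi_{n-1}) \oplus z^n\theta H^2(\mathbb{D}),\] where $\varphi_i = z^i p_i \theta - q_i$ for all $i = 0, \ldots, n-1$, and \[S_n\varphi_j \in (\mathbb{C}\varphi_{j+1} \oplus \cdots \oplus \mathbb{C}\varphi_{n-1})\oplus z^n\theta H^2(\mathbb{D})\] for all $j = 0, \ldots, n-2$, and $S_n\varphi_{n-1} = z^n p_{n-1}\theta$.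
   Context: $H^2(\mathbb{D})$ is the Hardy space on the open unit disc, $H^\infty(\mathbb{D})$ the bounded analytic functions on $\mathbb{D}$, and $M_z$ the unilateral shift on $H^2(\mathbb{D})$. All operators are bounded. A linear operator $F$ on $H^2(\mathbb{D})$ is an $n$-perturbation if (a) $Fz^m = 0$ for all $m \ge n$; (b) $F(z^m H^2(\mathbb{D})) \subseteq z^{m+1}\mathbb{C}[z]$ for all $m \ge 0$; and (c) $M_z + F$ is left-invertible. The symbol $\oplus$ denotes orthogonal direct sum. *)

theory Defs
  imports "HOL-Analysis.Analysis" "HOL-Computational_Algebra.Polynomial"
begin

text \<open>Elements of the Hardy space H^2(D) are represented by their Taylor coefficient
  sequences: f(z) = sum_k a k * z^k with square-summable coefficients.\<close>

type_synonym seq = "nat \<Rightarrow> complex"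

definition H2 :: "seq set" where
  "H2 = {a. summable (\<lambda>k. (cmod (a k))\<^sup>2)}"

definition h2_norm :: "seq \<Rightarrow> real" where
  "h2_norm a = sqrt (\<Sum>k. (cmod (a k))\<^sup>2)"

definition h2_inner :: "seq \<Rightarrow> seq \<Rightarrow> complex" where
  "h2_inner a b = (\<Sum>k. a k * cnj (b k))"

text \<open>Bounded linear operators on H^2 (only their action on H2 matters).\<close>
definition bounded_op :: "(seq \<Rightarrow> seq) \<Rightarrow> bool" where
  "bounded_op T \<longleftrightarrow>
     (\<forall>a\<in>H2. T a \<in> H2) \<and>
     (\<forall>a\<in>H2. \<forall>b\<in>H2. \<forall>c::complex. T (\<lambda>k. a k + c * b k) = (\<lambda>k. T a k + c * T b k)) \<and>
     (\<exists>C. \<forall>a\<in>H2. h2_norm (T a) \<le> C * h2_norm a)"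

definition Mz :: "seq \<Rightarrow> seq" where
  "Mz a = (\<lambda>k. if k = 0 then 0 else a (k - 1))"

definition zshift :: "nat \<Rightarrow> seq \<Rightarrow> seq" where
  "zshift m a = (\<lambda>k. if k < m then 0 else a (k - m))"

definition zmono :: "nat \<Rightarrow> seq" where
  "zmono m = (\<lambda>k. if k = m then 1 else 0)"

text \<open>Product of analytic functions = Cauchy product of coefficient sequences.\<close>
definition cprod :: "seq \<Rightarrow> seq \<Rightarrow> seq" where
  "cprod a b = (\<lambda>n. \<Sum>k\<le>n. a k * b (n - k))"

definition zH2 :: "nat \<Rightarrow> seq set" where
  "zH2 m = {a \<in> H2. \<forall>k<m. a k = 0}"

definition zpoly :: "nat \<Rightarrow> seq set" where
  "zpoly m = {coeff p | p :: complex poly. \<forall>k<m. coeff p k = 0}"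

definition Sop :: "(seq \<Rightarrow> seq) \<Rightarrow> seq \<Rightarrow> seq" where
  "Sop F a = (\<lambda>k. Mz a k + F a k)"

definition left_invertible :: "(seq \<Rightarrow> seq) \<Rightarrow> bool" where
  "left_invertible T \<longleftrightarrow> bounded_op T \<and> (\<exists>L. bounded_op L \<and> (\<forall>a\<in>H2. L (T a) = a))"

definition n_perturbation :: "nat \<Rightarrow> (seq \<Rightarrow> seq) \<Rightarrow> bool" where
  "n_perturbation n F \<longleftrightarrow>
     bounded_op F \<and>
     (\<forall>m\<ge>n. F (zmono m) = (\<lambda>_. 0)) \<and>
     (\<forall>m. \<forall>a\<in>zH2 m. F a \<in> zpoly (Suc m)) \<and>
     left_invertible (Sop F)"

definition closed_subspace :: "seq set \<Rightarrow> bool" where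
  "closed_subspace M \<longleftrightarrow>
     M \<subseteq> H2 \<and> (\<lambda>_. 0) \<in> M \<and>
     (\<forall>a\<in>M. \<forall>b\<in>M. \<forall>c::complex. (\<lambda>k. a k + c * b k) \<in> M) \<and>
     (\<forall>x a. (\<forall>j. x j \<in> M) \<longrightarrow> a \<in> H2 \<longrightarrow>
        (\<lambda>j. h2_norm (\<lambda>k. x j k - a k)) \<longlonglongrightarrow> 0 \<longrightarrow> a \<in> M)"

definition seq_fun :: "seq \<Rightarrow> complex \<Rightarrow> complex" where
  "seq_fun t z = (\<Sum>k. t k * z ^ k)"

definition Hinf :: "seq set" where
  "Hinf = {t. (\<forall>z. cmod z < 1 \<longrightarrow> summable (\<lambda>k. t k * z ^ k)) \<and>
              (\<exists>B. \<forall>z. cmod z < 1 \<longrightarrow> cmod (seq_fun t z) \<le> B)}"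

definition inner_fn :: "seq \<Rightarrow> bool" where
  "inner_fn t \<longleftrightarrow> t \<in> Hinf \<and>
     (AE s in lebesgue. s \<in> {0..2*pi} \<longrightarrow>
        (\<exists>L. cmod L = 1 \<and>
             ((\<lambda>r::real. seq_fun t (complex_of_real r * cis s)) \<longlongrightarrow> L) (at_left 1)))"

definition zthetaH2 :: "nat \<Rightarrow> seq \<Rightarrow> seq set" where
  "zthetaH2 n t = {zshift n (cprod t h) | h. h \<in> H2}"

definition phi :: "seq \<Rightarrow> complex poly \<Rightarrow> complex poly \<Rightarrow> nat \<Rightarrow> seq" where
  "phi t p q i = (\<lambda>k. zshift i (cprod (coeff p) t) k - coeff q k)"

text \<open>(span of the phi i, i in I) + G, as a set (orthogonality stated separately).\<close>
definition span_plus :: "(nat \<Rightarrow> seq) \<Rightarrow> nat set \<Rightarrow> seq set \<Rightarrow> seq set" where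
  "span_plus ph I G = {(\<lambda>k. (\<Sum>i\<in>I. c i * ph i k) + g k) | c g. g \<in> G}"

end

theory Submission
  imports Defs
begin

text \<open>
  Let \<open>S = M\<^sub>z + F\<close>. The operator \<open>F\<close> vanishes on \<open>z\<^sup>n H\<^sup>2\<close> and \<open>S\<close> raises the order of vanishing at \<open>0\<close>,
  so for an invariant \<open>M\<close> the layers \<open>M\<^sub>i = M \<inter> z\<^sup>i H\<^sup>2\<close> satisfy \<open>S M\<^sub>i \<subseteq> M\<^sub>i\<^sub>+\<^sub>1\<close>, and \<open>M\<^sub>n \<noteq> 0\<close> is invariant
  under the plain shift; Beurling's theorem gives \<open>M\<^sub>n = z\<^sup>n \<theta> H\<^sup>2\<close>. Take \<open>\<phi>\<^sub>i\<close> spanning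
  \<open>M\<^sub>i \<ominus> M\<^sub>i\<^sub>+\<^sub>1\<close>, which has dimension at most one. Since \<open>S\<^bsup>n-i\<^esup> \<phi>\<^sub>i = z\<^bsup>n-i\<^esup> \<phi>\<^sub>i + polynomial\<close> lies in \<open>M\<^sub>n\<close>,
  \<open>\<phi>\<^sub>i = z\<^sup>i \<theta> h - q\<close> with a polynomial \<open>q\<close>, and orthogonality to \<open>z\<^sup>n \<theta> H\<^sup>2\<close> kills all high coefficients
  of \<open>h\<close>, so \<open>h\<close> is a polynomial as well.

  That \<open>\<theta>\<close> is inner needs Fatou's theorem on radial limits. It follows from an \<open>L\<^sup>2\<close> maximal
  inequality, which is obtained by the \<open>T T*\<close> method instead of a covering argument; the boundary
  modulus is then \<open>1\<close> because \<open>\<theta>\<close> is bounded by \<open>1\<close> and has norm \<open>1\<close>.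
\<close>

section \<open>Square-summable sequences\<close>

text \<open>Functions are coefficient sequences, and boundary values enter only in the claim that
  \<theta> is inner. Beurling's theorem itself is proved by Hilbert space geometry. A unit vector
  z^n \<theta> of M_n of lowest order of vanishing, orthogonal to all of M_n of higher order, has
  orthonormal shifts. From this alone it follows that multiplication by \<theta> is a contraction of
  H^2, that |\<theta>| is at most 1 (test on reproducing kernels), and that nothing in M_n is left
  outside z^n \<theta> H^2, because monomials of high degree are nearly in \<theta> H^2.
  Left-invertibility gives injectivity of S, so \<open>S ^^ n\<close> maps a nonzero element of M to
  a nonzero element of M_n. Two successive layers may coincide; the generator is then 0, which still
  has the required form. The multiplier p_i of \<phi>_i is read off from the power of S that moves
  \<phi>_i into z^n \<theta> H^2; for i = n - 1 this power is S itself, which yields the last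
  condition. Conversely, S acts as M_z on z^n \<theta> H^2, and the conditions on the \<phi>_j
  settle the finitely many other generators.\<close>

definition nsq :: "seq \<Rightarrow> real" where
  "nsq a = (\<Sum>k. (cmod (a k))\<^sup>2)"

definition trunc :: "nat \<Rightarrow> seq \<Rightarrow> seq" where
  "trunc N a = (\<lambda>k. if k < N then a k else 0)"

lemma h2_norm_nsq: "h2_norm a = sqrt (nsq a)"
  by (simp add: h2_norm_def nsq_def)

lemma H2_summable: "a \<in> H2 \<Longrightarrow> summable (\<lambda>k. (cmod (a k))\<^sup>2)"
  by (simp add: H2_def)

lemma norm_add_scale_sq_le:
  fixes a b c :: complex
  shows "(cmod (a + c * b))\<^sup>2 \<le> 2 * (cmod a)\<^sup>2 + 2 * (cmod c)\<^sup>2 * (cmod b)\<^sup>2"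
proof -
  have "cmod (a + c * b) \<le> cmod a + cmod c * cmod b"
    by (metis norm_mult norm_triangle_ineq)
  hence "(cmod (a + c * b))\<^sup>2 \<le> (cmod a + cmod c * cmod b)\<^sup>2"
    by (intro power_mono) auto
  also have "\<dots> \<le> 2 * (cmod a)\<^sup>2 + 2 * (cmod c * cmod b)\<^sup>2"
    using sum_squares_bound[of "cmod a" "cmod c * cmod b"] by (simp add: power2_sum)
  finally show ?thesis by (simp add: power_mult_distrib)
qed

lemma H2_add_scale:
  assumes "a \<in> H2" "b \<in> H2"
  shows "(\<lambda>k. a k + c * b k) \<in> H2"
proof -
  have "summable (\<lambda>k. 2 * (cmod (a k))\<^sup>2 + 2 * (cmod c)\<^sup>2 * (cmod (b k))\<^sup>2)"
    using assms by (intro summable_add summable_mult) (auto simp: H2_def)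
  then have "summable (\<lambda>k. (cmod (a k + c * b k))\<^sup>2)"
    by (rule summable_comparison_test'[where N = 0]) (use norm_add_scale_sq_le in auto)
  thus ?thesis by (simp add: H2_def)
qed

lemma H2_zero: "(\<lambda>_. 0) \<in> H2"
  by (simp add: H2_def)

lemma H2_scale: "a \<in> H2 \<Longrightarrow> (\<lambda>k. c * a k) \<in> H2"
  using H2_add_scale[OF H2_zero, of a c] by simp

lemma H2_diff: "a \<in> H2 \<Longrightarrow> b \<in> H2 \<Longrightarrow> (\<lambda>k. a k - b k) \<in> H2"
  using H2_add_scale[of a b "-1"] by simp

lemma H2_finite_support: "(\<And>k. k \<ge> N \<Longrightarrow> a k = 0) \<Longrightarrow> a \<in> H2"
  unfolding H2_def by (auto intro!: summable_finite[of "{..<N}"] simp: not_le[symmetric])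

lemma H2_coeff: "coeff p \<in> H2"
  by (rule H2_finite_support[of "Suc (degree p)"]) (simp add: coeff_eq_0)

lemma H2_trunc: "trunc N a \<in> H2"
  by (rule H2_finite_support[of N]) (simp add: trunc_def)

lemma zmono_H2: "zmono m \<in> H2"
  by (rule H2_finite_support[of "Suc m"]) (simp add: zmono_def)

lemma nsq_nonneg: "a \<in> H2 \<Longrightarrow> nsq a \<ge> 0"
  unfolding nsq_def by (intro suminf_nonneg) (auto simp: H2_def)

lemma nsq_partial_le: "a \<in> H2 \<Longrightarrow> finite A \<Longrightarrow> (\<Sum>k\<in>A. (cmod (a k))\<^sup>2) \<le> nsq a"
  unfolding nsq_def by (intro sum_le_suminf) (auto simp: H2_def)

lemma nsq_coord_le: "a \<in> H2 \<Longrightarrow> (cmod (a k))\<^sup>2 \<le> nsq a"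
  using nsq_partial_le[of a "{k}"] by simp

lemma nsq_zero_imp:
  assumes "a \<in> H2" "nsq a \<le> 0"
  shows "a = (\<lambda>_. 0)"
proof
  fix k
  have "(cmod (a k))\<^sup>2 \<le> 0" using nsq_coord_le[OF assms(1), of k] assms(2) by linarith
  thus "a k = 0" by simp
qed

lemma H2_bounded_partial:
  assumes "\<And>N. (\<Sum>k<N. (cmod (a k))\<^sup>2) \<le> B"
  shows "a \<in> H2" "nsq a \<le> B"
proof -
  show *: "a \<in> H2" unfolding H2_def using assms
    by (auto intro!: summableI_nonneg_bounded)
  show "nsq a \<le> B" unfolding nsq_def
    by (rule suminf_le_const) (use * assms in \<open>auto simp: H2_def\<close>)
qed

section \<open>Inner product, orthogonality and completeness\<close>

lemma h2_inner_abs_summable: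
  assumes "a \<in> H2" "b \<in> H2"
  shows "summable (\<lambda>k. cmod (a k * cnj (b k)))"
proof (rule summable_comparison_test'[where N = 0])
  show "summable (\<lambda>k. (cmod (a k))\<^sup>2 + (cmod (b k))\<^sup>2)"
    using assms by (intro summable_add) (auto simp: H2_def)
  show "norm (cmod (a k * cnj (b k))) \<le> (cmod (a k))\<^sup>2 + (cmod (b k))\<^sup>2" for k
  proof -
    have "0 \<le> cmod (a k) * cmod (b k)" by simp
    thus ?thesis using sum_squares_bound[of "cmod (a k)" "cmod (b k)"]
      unfolding norm_mult complex_mod_cnj real_norm_def abs_mult abs_norm_cancel by linarith
  qed
qed

lemma h2_inner_summable:
  assumes "a \<in> H2" "b \<in> H2"
  shows "summable (\<lambda>k. a k * cnj (b k))"
  using h2_inner_abs_summable[OF assms] by (rule summable_norm_cancel)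

lemma h2_inner_add_scale:
  assumes "a \<in> H2" "b \<in> H2" "d \<in> H2"
  shows "h2_inner (\<lambda>k. a k + c * b k) d = h2_inner a d + c * h2_inner b d"
proof -
  have "h2_inner (\<lambda>k. a k + c * b k) d = (\<Sum>k. a k * cnj (d k) + c * (b k * cnj (d k)))"
    unfolding h2_inner_def by (simp add: algebra_simps)
  also have "\<dots> = h2_inner a d + c * h2_inner b d"
    unfolding h2_inner_def
    using h2_inner_summable[OF assms(1,3)] h2_inner_summable[OF assms(2,3)]
    by (simp add: suminf_add[symmetric] suminf_mult summable_mult)
  finally show ?thesis .
qed

lemma h2_inner_commute:
  assumes "a \<in> H2" "b \<in> H2"
  shows "h2_inner b a = cnj (h2_inner a b)"
proof -
  have "(\<lambda>k. cnj (a k * cnj (b k))) sums cnj (h2_inner a b)"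
    unfolding h2_inner_def sums_cnj using h2_inner_summable[OF assms] by (rule summable_sums)
  moreover have "(\<lambda>k. cnj (a k * cnj (b k))) = (\<lambda>k. b k * cnj (a k))" by (auto simp: mult.commute)
  ultimately show ?thesis unfolding h2_inner_def[of b a] by (simp add: sums_iff)
qed

lemma h2_inner_self:
  assumes "a \<in> H2"
  shows "h2_inner a a = of_real (nsq a)"
proof -
  have "(\<lambda>k. complex_of_real ((cmod (a k))\<^sup>2)) sums of_real (nsq a)"
    unfolding nsq_def using H2_summable[OF assms] by (intro sums_of_real summable_sums)
  moreover have "(\<lambda>k. complex_of_real ((cmod (a k))\<^sup>2)) = (\<lambda>k. a k * cnj (a k))"
    by (intro ext) (metis complex_norm_square)
  ultimately show ?thesis unfolding h2_inner_def by (simp add: sums_iff)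
qed

lemma h2_inner_zero [simp]: "h2_inner (\<lambda>_. 0) b = 0" "h2_inner b (\<lambda>_. 0) = 0"
  by (simp_all add: h2_inner_def)

lemma h2_inner_scale:
  assumes "b \<in> H2" "d \<in> H2"
  shows "h2_inner (\<lambda>k. c * b k) d = c * h2_inner b d"
  using h2_inner_add_scale[OF H2_zero assms, of c] by simp

lemma h2_inner_diff:
  assumes "a \<in> H2" "b \<in> H2" "d \<in> H2"
  shows "h2_inner (\<lambda>k. a k - b k) d = h2_inner a d - h2_inner b d"
  using h2_inner_add_scale[OF assms, of "-1"] by simp

lemma h2_inner_add_scale_right:
  assumes "a \<in> H2" "b \<in> H2" "d \<in> H2"
  shows "h2_inner d (\<lambda>k. a k + c * b k) = h2_inner d a + cnj c * h2_inner d b"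
  by (subst h2_inner_commute) (auto intro!: assms H2_add_scale
      simp: h2_inner_add_scale assms h2_inner_commute[of d])

lemma nsq_add_scale:
  assumes "a \<in> H2" "b \<in> H2"
  shows "nsq (\<lambda>k. a k + c * b k) = nsq a + 2 * Re (cnj c * h2_inner a b) + (cmod c)\<^sup>2 * nsq b"
proof -
  have "complex_of_real (nsq (\<lambda>k. a k + c * b k)) = 
      h2_inner a a + cnj c * h2_inner a b + c * (h2_inner b a + cnj c * h2_inner b b)"
    by (subst h2_inner_self[symmetric])
       (auto simp: assms H2_add_scale h2_inner_add_scale h2_inner_add_scale_right)
  also have "\<dots> = of_real (nsq a) + (cnj c * h2_inner a b + cnj (cnj c * h2_inner a b)) + (c * cnj c) * of_real (nsq b)"
    using assms by (simp add: h2_inner_self h2_inner_commute[of a b] algebra_simps)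
  also have "\<dots> = of_real (nsq a + 2 * Re (cnj c * h2_inner a b) + (cmod c)\<^sup>2 * nsq b)"
    by (simp only: complex_add_cnj complex_norm_square[symmetric] of_real_add of_real_mult)
  finally show ?thesis by (simp only: of_real_eq_iff)
qed

lemma nsq_minimal_imp_orthogonal:
  assumes "a \<in> H2" "g \<in> H2" "\<And>c. nsq a \<le> nsq (\<lambda>k. a k + c * g k)"
  shows "h2_inner a g = 0"
proof (cases "nsq g \<le> 0")
  case True
  thus ?thesis using nsq_zero_imp[OF assms(2)] by simp
next
  case False
  \<comment> \<open>The minimiser of the quadratic function of \<open>c\<close> given by
    \<open>nsq_add_scale\<close>.\<close>
  define c where "c = - h2_inner a g / of_real (nsq g)"
  have 1: "cnj c * h2_inner a g = - of_real ((cmod (h2_inner a g))\<^sup>2 / nsq g)"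
    unfolding c_def of_real_divide complex_norm_square by simp
  have 2: "(cmod c)\<^sup>2 * nsq g = (cmod (h2_inner a g))\<^sup>2 / nsq g"
    using False unfolding c_def by (simp add: norm_divide power_divide power2_eq_square)
  have "nsq a \<le> nsq a - 2 * ((cmod (h2_inner a g))\<^sup>2 / nsq g) + (cmod (h2_inner a g))\<^sup>2 / nsq g"
    using assms(3)[of c] unfolding nsq_add_scale[OF assms(1,2)] 1 2 by simp
  hence "(cmod (h2_inner a g))\<^sup>2 / nsq g \<le> 0" by simp
  hence "(cmod (h2_inner a g))\<^sup>2 \<le> 0" using False by (simp add: divide_le_0_iff)
  thus ?thesis by simp
qed

lemma h2_Cauchy_Schwarz:
  assumes "a \<in> H2" "b \<in> H2"
  shows "(cmod (h2_inner a b))\<^sup>2 \<le> nsq a * nsq b"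
proof (cases "nsq b \<le> 0")
  case True
  thus ?thesis using nsq_zero_imp[OF assms(2)] nsq_nonneg[OF assms(2)] by simp
next
  case False
  \<comment> \<open>Again the minimising coefficient; nonnegativity of the minimum is the
    claim.\<close>
  define c where "c = - h2_inner a b / of_real (nsq b)"
  have 1: "cnj c * h2_inner a b = - of_real ((cmod (h2_inner a b))\<^sup>2 / nsq b)"
    unfolding c_def of_real_divide complex_norm_square by simp
  have 2: "(cmod c)\<^sup>2 * nsq b = (cmod (h2_inner a b))\<^sup>2 / nsq b"
    using False unfolding c_def by (simp add: norm_divide power_divide power2_eq_square)
  have "0 \<le> nsq a - 2 * ((cmod (h2_inner a b))\<^sup>2 / nsq b) + (cmod (h2_inner a b))\<^sup>2 / nsq b"
    using nsq_nonneg[OF H2_add_scale[OF assms, of c]] unfolding nsq_add_scale[OF assms] 1 2 by simp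
  hence "(cmod (h2_inner a b))\<^sup>2 / nsq b \<le> nsq a" by simp
  thus ?thesis using False by (simp add: pos_divide_le_eq)
qed

lemma nsq_diff_trunc_tendsto:
  assumes "a \<in> H2"
  shows "(\<lambda>N. nsq (\<lambda>k. a k - trunc N a k)) \<longlonglongrightarrow> 0"
proof -
  have s: "summable (\<lambda>k. (cmod (a k))\<^sup>2)" using assms by (rule H2_summable)
  have "nsq (\<lambda>k. a k - trunc N a k) = nsq a - (\<Sum>k<N. (cmod (a k))\<^sup>2)" for N
  proof -
    have "(\<lambda>k. (cmod (trunc N a k))\<^sup>2) sums (\<Sum>k<N. (cmod (trunc N a k))\<^sup>2)"
      by (intro sums_finite) (auto simp: trunc_def)
    also have "(\<Sum>k<N. (cmod (trunc N a k))\<^sup>2) = (\<Sum>k<N. (cmod (a k))\<^sup>2)"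
      by (intro sum.cong) (auto simp: trunc_def)
    finally have "(\<lambda>k. (cmod (a k))\<^sup>2 - (cmod (trunc N a k))\<^sup>2) sums (nsq a - (\<Sum>k<N. (cmod (a k))\<^sup>2))"
      unfolding nsq_def by (intro sums_diff summable_sums s)
    also have "(\<lambda>k. (cmod (a k))\<^sup>2 - (cmod (trunc N a k))\<^sup>2) = (\<lambda>k. (cmod (a k - trunc N a k))\<^sup>2)"
      by (auto simp: trunc_def)
    finally show ?thesis unfolding nsq_def[of "\<lambda>k. a k - trunc N a k"] by (simp add: sums_iff)
  qed
  moreover have "(\<lambda>N. nsq a - (\<Sum>k<N. (cmod (a k))\<^sup>2)) \<longlonglongrightarrow> nsq a - nsq a"
    unfolding nsq_def by (intro tendsto_diff tendsto_const summable_LIMSEQ s)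
  ultimately show ?thesis by simp
qed

lemma h2_inner_tendsto_left:
  assumes "\<And>N. x N \<in> H2" "a \<in> H2" "d \<in> H2" "(\<lambda>N. nsq (\<lambda>k. a k - x N k)) \<longlonglongrightarrow> 0"
  shows "(\<lambda>N. h2_inner (x N) d) \<longlonglongrightarrow> h2_inner a d"
proof -
  have "(\<lambda>N. sqrt (nsq (\<lambda>k. a k - x N k) * nsq d)) \<longlonglongrightarrow> sqrt (0 * nsq d)"
    by (intro tendsto_intros assms)
  hence lim: "(\<lambda>N. sqrt (nsq (\<lambda>k. a k - x N k) * nsq d)) \<longlonglongrightarrow> 0" by simp
  have "norm (h2_inner a d - h2_inner (x N) d) \<le> sqrt (nsq (\<lambda>k. a k - x N k) * nsq d)" for N
    using h2_Cauchy_Schwarz[OF H2_diff[OF assms(2) assms(1)[of N]] assms(3)]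
    by (intro real_le_rsqrt) (simp add: h2_inner_diff assms)
  hence "(\<lambda>N. h2_inner a d - h2_inner (x N) d) \<longlonglongrightarrow> 0"
    by (intro Lim_null_comparison[OF _ lim]) auto
  from tendsto_diff[OF tendsto_const[of "h2_inner a d"] this] show ?thesis by simp
qed

text \<open>Each coordinate is Cauchy. Finite partial sums of the squared distance then pass to the
  limit in \<open>j\<close>, which leaves the bound \<open>e i\<close>. The Cauchy condition has the
  quantitative shape that a minimising sequence supplies.\<close>

lemma H2_complete:
  assumes x: "\<And>i. x i \<in> H2" and e: "e \<longlonglongrightarrow> 0"
    and le: "\<And>i j. nsq (\<lambda>k. x i k - x j k) \<le> e i + e j"
  obtains a where "a \<in> H2" "\<And>i. nsq (\<lambda>k. x i k - a k) \<le> e i" "\<And>k. (\<lambda>i. x i k) \<longlonglongrightarrow> a k"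
proof -
  have coord: "(cmod (x i k - x j k))\<^sup>2 \<le> e i + e j" for i j k
    using nsq_coord_le[OF H2_diff[OF x x], of i k j] le[of i j] by linarith
  have "Cauchy (\<lambda>i. x i k)" for k
  proof (rule metric_CauchyI)
    fix d :: real assume d: "d > 0"
    hence "eventually (\<lambda>i. e i < d\<^sup>2 / 2) sequentially"
      using e by (intro order_tendstoD) auto
    then obtain K where K: "\<And>i. i \<ge> K \<Longrightarrow> e i < d\<^sup>2 / 2" by (auto simp: eventually_sequentially)
    have "dist (x i k) (x j k) < d" if "i \<ge> K" "j \<ge> K" for i j
    proof -
      have "(cmod (x i k - x j k))\<^sup>2 < d\<^sup>2"
        using coord[of i k j] K[OF that(1)] K[OF that(2)] by linarith
      thus ?thesis using d by (simp add: dist_norm power2_less_imp_less)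
    qed
    thus "\<exists>M. \<forall>m\<ge>M. \<forall>n\<ge>M. dist (x m k) (x n k) < d" by blast
  qed
  hence "\<forall>k. \<exists>l. (\<lambda>i. x i k) \<longlonglongrightarrow> l" by (simp add: Cauchy_convergent convergent_def[symmetric])
  then obtain a where a: "\<And>k. (\<lambda>i. x i k) \<longlonglongrightarrow> a k" by metis
  have part: "(\<Sum>k<K. (cmod (x i k - a k))\<^sup>2) \<le> e i" for i K
  proof -
    have l1: "(\<lambda>j. \<Sum>k<K. (cmod (x i k - x j k))\<^sup>2) \<longlonglongrightarrow> (\<Sum>k<K. (cmod (x i k - a k))\<^sup>2)"
      by (intro tendsto_intros a)
    have l2: "(\<lambda>j. e i + e j) \<longlonglongrightarrow> e i + 0" by (intro tendsto_intros e)
    have "(\<Sum>k<K. (cmod (x i k - x j k))\<^sup>2) \<le> e i + e j" for j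
      using nsq_partial_le[OF H2_diff[OF x x], of "{..<K}" i j] le[of i j] by simp
    thus ?thesis using LIMSEQ_le[OF l1 l2] by auto
  qed
  note d = H2_bounded_partial[OF part]
  have "a \<in> H2" using H2_diff[OF x[of 0] d(1)[of 0]] by simp
  thus ?thesis using that d(2) a by blast
qed

section \<open>Closed subspaces and elements of minimal norm\<close>

lemma closed_subspace_H2: "closed_subspace M \<Longrightarrow> a \<in> M \<Longrightarrow> a \<in> H2"
  unfolding closed_subspace_def by blast

lemma closed_subspace_add_scale:
  "closed_subspace M \<Longrightarrow> a \<in> M \<Longrightarrow> b \<in> M \<Longrightarrow> (\<lambda>k. a k + c * b k) \<in> M"
  unfolding closed_subspace_def by blast

lemma closed_subspace_zero: "closed_subspace M \<Longrightarrow> (\<lambda>_. 0) \<in> M"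
  unfolding closed_subspace_def by blast

lemma closed_subspace_scale:
  "closed_subspace M \<Longrightarrow> b \<in> M \<Longrightarrow> (\<lambda>k. c * b k) \<in> M"
  using closed_subspace_add_scale[of M "\<lambda>_. 0" b c] closed_subspace_zero[of M] by simp

lemma closed_subspace_diff:
  "closed_subspace M \<Longrightarrow> a \<in> M \<Longrightarrow> b \<in> M \<Longrightarrow> (\<lambda>k. a k - b k) \<in> M"
  using closed_subspace_add_scale[of M a b "-1"] by simp

lemma closed_subspace_sum:
  assumes "closed_subspace M" "finite A" "\<And>i. i \<in> A \<Longrightarrow> f i \<in> M"
  shows "(\<lambda>k. \<Sum>i\<in>A. c i * f i k) \<in> M"
  using assms(2,3)
proof (induction A rule: finite_induct)
  case empty
  thus ?case using closed_subspace_zero[OF assms(1)] by simp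
next
  case (insert i A)
  have "(\<lambda>k. (\<Sum>i\<in>A. c i * f i k) + c i * f i k) \<in> M"
    by (rule closed_subspace_add_scale[OF assms(1)]) (use insert in auto)
  thus ?case using insert by (simp add: add.commute)
qed

lemma closed_subspace_limit:
  assumes "closed_subspace M" "\<And>j. x j \<in> M" "a \<in> H2" "(\<lambda>j. nsq (\<lambda>k. a k - x j k)) \<longlonglongrightarrow> 0"
  shows "a \<in> M"
proof -
  have "nsq (\<lambda>k. a k - x j k) = nsq (\<lambda>k. x j k - a k)" for j
    unfolding nsq_def by (simp add: norm_minus_commute)
  hence "(\<lambda>j. h2_norm (\<lambda>k. x j k - a k)) \<longlonglongrightarrow> sqrt 0"
    unfolding h2_norm_nsq using assms(4) by (intro tendsto_real_sqrt) simp
  hence "(\<lambda>j. h2_norm (\<lambda>k. x j k - a k)) \<longlonglongrightarrow> 0" by simp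
  thus ?thesis using assms(1-3) unfolding closed_subspace_def by blast
qed

text \<open>Minimising the norm over the affine slice \<open>V\<close> takes the place of an
  orthogonal projection: adding an element of \<open>K\<close> that vanishes beyond order
  \<open>m\<close> does not leave \<open>V\<close>, so minimality forces orthogonality to
  it.\<close>

lemma closed_subspace_min_norm:
  assumes K: "closed_subspace K" and ex: "b \<in> K" "\<And>k. k < m \<Longrightarrow> b k = 0" "b m = 1"
  obtains a where "a \<in> K" "\<And>k. k < m \<Longrightarrow> a k = 0" "a m = 1"
    "\<And>g. g \<in> K \<Longrightarrow> (\<And>k. k \<le> m \<Longrightarrow> g k = 0) \<Longrightarrow> h2_inner a g = 0"
proof -
  define V where "V = {a\<in>K. (\<forall>k<m. a k = 0) \<and> a m = 1}"
  have VH: "a \<in> H2" if "a \<in> V" for a using that K by (auto simp: V_def intro: closed_subspace_H2)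
  define d where "d = Inf (nsq ` V)"
  have ne: "nsq ` V \<noteq> {}" using ex unfolding V_def by auto
  have bdd: "bdd_below (nsq ` V)" using VH nsq_nonneg by (intro bdd_belowI[of _ 0]) auto
  have d_le: "d \<le> nsq a" if "a \<in> V" for a unfolding d_def using that bdd by (intro cInf_lower) auto
  have "\<exists>a\<in>V. nsq a < d + 1 / real (Suc j)" for j
    using cInf_lessD[OF ne, of "d + 1 / real (Suc j)"] unfolding d_def by auto
  then obtain x where x: "\<And>j. x j \<in> V" "\<And>j. nsq (x j) < d + 1 / real (Suc j)" by metis
  have le: "nsq (\<lambda>k. x i k - x j k) \<le> 2 / real (Suc i) + 2 / real (Suc j)" for i j
  proof -
    \<comment> \<open>The midpoint lies in \<open>V\<close>, hence has squared norm at least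
      \<open>d\<close>, and the parallelogram law bounds the distance of \<open>x i\<close> and
      \<open>x j\<close>. The coefficients 1 and -1 match the form of
      \<open>nsq_add_scale\<close>.\<close>
    let ?y = "\<lambda>k. (1/2) * (x i k + 1 * x j k)"
    have xH: "x i \<in> H2" "x j \<in> H2" using x VH by auto
    have "?y \<in> K" by (intro closed_subspace_scale closed_subspace_add_scale K) (use x in \<open>auto simp: V_def\<close>)
    hence "?y \<in> V" using x(1)[of i] x(1)[of j] by (auto simp: V_def)
    hence "d \<le> nsq ?y" by (rule d_le)
    also have "nsq ?y = (1/4) * nsq (\<lambda>k. x i k + 1 * x j k)"
      using nsq_add_scale[OF H2_zero H2_add_scale[OF xH, of 1], of "1/2"]
      by (simp add: nsq_def power2_eq_square norm_divide)
    finally have "4 * d \<le> nsq (\<lambda>k. x i k + 1 * x j k)" by simp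
    moreover have "nsq (\<lambda>k. x i k + 1 * x j k) + nsq (\<lambda>k. x i k + (-1) * x j k) = 2 * nsq (x i) + 2 * nsq (x j)"
      unfolding nsq_add_scale[OF xH] by simp
    ultimately have "nsq (\<lambda>k. x i k + (-1) * x j k) \<le> 2 * nsq (x i) + 2 * nsq (x j) - 4 * d" by linarith
    thus ?thesis using x(2)[of i] x(2)[of j] by simp
  qed
  have e: "(\<lambda>i. 2 / real (Suc i)) \<longlonglongrightarrow> 0"
    using tendsto_mult_right_zero[OF LIMSEQ_inverse_real_of_nat, of 2] by (simp add: field_simps)
  obtain a where a: "a \<in> H2" "\<And>i. nsq (\<lambda>k. x i k - a k) \<le> 2 / real (Suc i)" "\<And>k. (\<lambda>i. x i k) \<longlonglongrightarrow> a k"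
    using H2_complete[of x, OF VH[OF x(1)] e le] by blast
  have aK: "a \<in> K"
  proof (rule closed_subspace_limit[OF K _ a(1)])
    show "x j \<in> K" for j using x by (auto simp: V_def)
    have "nsq (\<lambda>k. a k - x j k) \<le> 2 / real (Suc j)" for j
      using a(2)[of j] by (simp add: nsq_def norm_minus_commute)
    thus "(\<lambda>j. nsq (\<lambda>k. a k - x j k)) \<longlonglongrightarrow> 0"
      using nsq_nonneg[OF H2_diff[OF a(1) VH[OF x(1)]]]
      by (intro tendsto_sandwich[OF _ _ tendsto_const e]) auto
  qed
  have a0: "a k = 0" if "k < m" for k
  proof -
    have "(\<lambda>i. x i k) = (\<lambda>i. 0)" using x(1) that by (auto simp: V_def)
    thus ?thesis using a(3)[of k] LIMSEQ_unique tendsto_const by metis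
  qed
  have "(\<lambda>i. x i m) = (\<lambda>i. 1)" using x(1) by (auto simp: V_def)
  hence a1: "a m = 1" using a(3)[of m] LIMSEQ_unique tendsto_const by metis
  have "(\<Sum>k<N. (cmod (a k))\<^sup>2) \<le> d" for N
  proof -
    have l1: "(\<lambda>j. \<Sum>k<N. (cmod (x j k))\<^sup>2) \<longlonglongrightarrow> (\<Sum>k<N. (cmod (a k))\<^sup>2)"
      by (intro tendsto_intros a)
    have l2: "(\<lambda>j. d + 1 / real (Suc j)) \<longlonglongrightarrow> d + 0"
      using LIMSEQ_inverse_real_of_nat by (intro tendsto_intros) (simp add: field_simps)
    have "(\<Sum>k<N. (cmod (x j k))\<^sup>2) \<le> d + 1 / real (Suc j)" for j
      using nsq_partial_le[OF VH[OF x(1)], of "{..<N}" j] x(2)[of j] by simp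
    thus ?thesis using LIMSEQ_le[OF l1 l2] by auto
  qed
  hence na: "nsq a \<le> d" by (rule H2_bounded_partial)
  have "h2_inner a g = 0" if g: "g \<in> K" "\<And>k. k \<le> m \<Longrightarrow> g k = 0" for g
  proof (rule nsq_minimal_imp_orthogonal[OF a(1) closed_subspace_H2[OF K g(1)]])
    fix c
    have "(\<lambda>k. a k + c * g k) \<in> V"
      unfolding V_def using closed_subspace_add_scale[OF K aK g(1)] a0 a1 g(2) by auto
    thus "nsq a \<le> nsq (\<lambda>k. a k + c * g k)" using d_le na by fastforce
  qed
  thus ?thesis using that aK a0 a1 by blast
qed

text \<open>\<open>a\<close> spans the orthogonal difference of two successive layers of
  \<open>K\<close>. If some element has order exactly \<open>m\<close>, then \<open>a\<close> is
  normalised by \<open>a m = 1\<close>; otherwise the layers coincide, every \<open>b m\<close> is 0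
  and \<open>a\<close> is zero. Subtracting \<open>b m * a k\<close> is right in both cases.\<close>

lemma closed_subspace_layer:
  assumes K: "closed_subspace K"
  obtains a where "a \<in> K" "a \<in> zH2 m"
    "\<And>g. g \<in> K \<Longrightarrow> g \<in> zH2 (Suc m) \<Longrightarrow> h2_inner a g = 0"
    "\<And>b. b \<in> K \<Longrightarrow> b \<in> zH2 m \<Longrightarrow> (\<lambda>k. b k - b m * a k) \<in> zH2 (Suc m)"
proof (cases "\<exists>b\<in>K. b \<in> zH2 m \<and> b m \<noteq> 0")
  case False
  have "(\<lambda>k. b k - b m * 0) \<in> zH2 (Suc m)" if "b \<in> K" "b \<in> zH2 m" for b
    using False that by (auto simp: zH2_def less_Suc_eq)
  moreover have "(\<lambda>_. 0) \<in> zH2 m" by (simp add: zH2_def H2_zero)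
  ultimately show ?thesis using that[of "\<lambda>_. 0"] closed_subspace_zero[OF K] by simp
next
  case True
  then obtain b where b: "b \<in> K" "b \<in> zH2 m" "b m \<noteq> 0" by blast
  have "(\<lambda>k. inverse (b m) * b k) \<in> K" by (rule closed_subspace_scale[OF K b(1)])
  then obtain a where a: "a \<in> K" "\<And>k. k < m \<Longrightarrow> a k = 0" "a m = 1"
    "\<And>g. g \<in> K \<Longrightarrow> (\<And>k. k \<le> m \<Longrightarrow> g k = 0) \<Longrightarrow> h2_inner a g = 0"
    by (rule closed_subspace_min_norm[OF K, of _ m]) (use b in \<open>auto simp: zH2_def\<close>)
  have aH: "a \<in> H2" using closed_subspace_H2[OF K a(1)] .
  show ?thesis
  proof (rule that[OF a(1)])
    show "a \<in> zH2 m" using aH a by (simp add: zH2_def)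
    show "h2_inner a g = 0" if "g \<in> K" "g \<in> zH2 (Suc m)" for g
      using a(4)[OF that(1)] that(2) by (auto simp: zH2_def)
    show "(\<lambda>k. b k - b m * a k) \<in> zH2 (Suc m)" if "b \<in> K" "b \<in> zH2 m" for b
      using that a H2_add_scale[OF closed_subspace_H2[OF K that(1)] aH, of "- b m"]
      by (auto simp: zH2_def less_Suc_eq)
  qed
qed

section \<open>An abstract maximal inequality\<close>

text \<open>The real part of the Szego kernel, with \<open>z\<close> standing for the product of one
  point and the conjugate of another.\<close>

definition szego :: "complex \<Rightarrow> real" where
  "szego z = Re (1 / (1 - z))"

text \<open>Half the Poisson kernel plus one half. In this form positivity is visible, and kernels
  at different radii can be compared through numerator and denominator separately.\<close>

lemma szego_eq:
  assumes "cmod z < 1"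
  shows "szego z = ((1 - (cmod z)\<^sup>2) / (cmod (1 - z))\<^sup>2 + 1) / 2"
proof -
  have ne: "1 - z \<noteq> 0" using assms by auto
  have "2 * (1 - Re z) = 1 - (cmod z)\<^sup>2 + (cmod (1 - z))\<^sup>2"
    unfolding cmod_power2 by (simp add: power2_eq_square algebra_simps)
  moreover have "szego z = (1 - Re z) / (cmod (1 - z))\<^sup>2"
    unfolding szego_def by (simp add: Re_divide cmod_power2)
  moreover have "(cmod (1 - z))\<^sup>2 \<noteq> 0" using ne by simp
  ultimately show ?thesis by (simp add: field_simps)
qed

lemma szego_nonneg:
  assumes "cmod z < 1"
  shows "szego z \<ge> 0"
proof -
  have "(cmod z)\<^sup>2 \<le> 1" using assms by (simp add: abs_square_le_1)
  thus ?thesis unfolding szego_eq[OF assms] by simp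
qed

text \<open>Shrinking the smaller radius \<open>x\<close> by the factor \<open>y\<close> moves the
  point by at most its distance from 1, so \<open>cmod (1 - ?z)\<close> is at most twice
  \<open>cmod (1 - ?w)\<close>; squared, this costs a factor 4. The numerator 1 - x^2 costs another
  4, which gives 16.\<close>

lemma szego_mult_le_aux:
  assumes "0 \<le> x" "x \<le> y" "y < 1" "cmod u = 1"
  shows "szego (of_real x * of_real y * u) \<le> 16 * szego (of_real x * u)"
proof -
  let ?z = "of_real x * u" and ?w = "of_real x * of_real y * u"
  have x1: "x < 1" using assms by linarith
  have xy: "x * y \<le> x" "0 \<le> x * y" using assms by (simp_all add: mult_left_le)
  have cz: "cmod ?z = x" and cw: "cmod ?w = x * y" using assms by (simp_all add: norm_mult)
  have cz1: "cmod ?z < 1" and cw1: "cmod ?w < 1" using cz cw x1 xy by linarith+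
  have "?z - ?w = of_real (x * (1 - y)) * u" by (simp add: algebra_simps)
  hence "cmod (?z - ?w) = \<bar>x * (1 - y)\<bar>" using assms(4) by (simp only: norm_mult norm_of_real mult_1_right)
  hence "cmod (?z - ?w) = x * (1 - y)" using assms by simp
  also have "\<dots> \<le> 1 - x * y" using x1 by (simp add: algebra_simps)
  also have "\<dots> \<le> cmod (1 - ?w)" using norm_triangle_ineq2[of 1 ?w] cw by simp
  finally have "cmod (?z - ?w) \<le> cmod (1 - ?w)" .
  moreover have "cmod (1 - ?z) \<le> cmod (1 - ?w) + cmod (?z - ?w)"
    using norm_triangle_ineq4[of "1 - ?w" "?z - ?w"] by simp
  ultimately have "cmod (1 - ?z) \<le> 2 * cmod (1 - ?w)" by linarith
  hence "(cmod (1 - ?z))\<^sup>2 \<le> (2 * cmod (1 - ?w))\<^sup>2" by (intro power_mono) auto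
  hence d: "(cmod (1 - ?z))\<^sup>2 \<le> 4 * (cmod (1 - ?w))\<^sup>2" by (simp add: power_mult_distrib)
  have "1 - (x * y)\<^sup>2 = (1 - x * y) * (1 + x * y)" by (simp add: power2_eq_square algebra_simps)
  also have "\<dots> \<le> (2 * (1 - x)) * 2"
  proof (intro mult_mono)
    have "1 - x * y = (1 - x) + x * (1 - y)" by (simp add: algebra_simps)
    also have "\<dots> \<le> (1 - x) + 1 * (1 - x)"
      using assms x1 by (intro add_left_mono mult_mono) auto
    finally show "1 - x * y \<le> 2 * (1 - x)" by simp
  qed (use xy x1 in auto)
  also have "\<dots> \<le> 4 * (1 - x\<^sup>2)"
    using mult_left_mono[of x 1 x] assms x1 by (simp add: power2_eq_square)
  finally have n: "1 - (x * y)\<^sup>2 \<le> 4 * (1 - x\<^sup>2)" .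
  have pz: "(cmod (1 - ?z))\<^sup>2 > 0" using cz1 by auto
  have pw: "(cmod (1 - ?w))\<^sup>2 > 0" using cw1 by auto
  have x2: "0 \<le> 1 - x\<^sup>2" using assms x1 by (simp add: abs_square_le_1)
  have "(1 - (x * y)\<^sup>2) / (cmod (1 - ?w))\<^sup>2 \<le> (4 * (1 - x\<^sup>2)) / ((cmod (1 - ?z))\<^sup>2 / 4)"
    using d n pz pw x2 by (intro frac_le) auto
  also have "\<dots> = 16 * ((1 - x\<^sup>2) / (cmod (1 - ?z))\<^sup>2)" by simp
  finally show ?thesis unfolding szego_eq[OF cz1] szego_eq[OF cw1] cz cw by argo
qed

text \<open>The smaller radius decides which kernel dominates; as both are nonnegative, their sum
  dominates in either case.\<close>

lemma szego_mult_le: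
  assumes "0 \<le> x" "x < 1" "0 \<le> y" "y < 1" "cmod u = 1"
  shows "szego (of_real x * of_real y * u) \<le> 16 * (szego (of_real x * u) + szego (of_real y * u))"
proof -
  have nn: "szego (of_real x * u) \<ge> 0" "szego (of_real y * u) \<ge> 0"
    using assms by (auto intro!: szego_nonneg simp: norm_mult)
  show ?thesis
  proof (cases "x \<le> y")
    case True
    show ?thesis using szego_mult_le_aux[OF assms(1) True assms(4,5)] nn
      by (auto intro: order.trans simp del: of_real_mult)
  next
    case False
    hence "szego (of_real y * of_real x * u) \<le> 16 * szego (of_real y * u)"
      using assms by (intro szego_mult_le_aux) auto
    thus ?thesis using nn by (simp add: mult.commute)
  qed
qed

lemma szego_cnj: "szego (cnj z) = szego z"
proof -
  have "1 / (1 - cnj z) = cnj (1 / (1 - z))" by simp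
  thus ?thesis unfolding szego_def by (simp only: cnj.simps)
qed

lemma abs_szego_le:
  assumes "cmod z \<le> q" "q < 1"
  shows "\<bar>szego z\<bar> \<le> 1 / (1 - q)"
proof -
  have "\<bar>szego z\<bar> \<le> cmod (1 / (1 - z))" unfolding szego_def by (rule abs_Re_le_cmod)
  also have "\<dots> = 1 / cmod (1 - z)" by (simp add: norm_divide)
  also have "\<dots> \<le> 1 / (1 - q)"
    using norm_triangle_ineq2[of 1 z] assms by (intro divide_left_mono mult_pos_pos) auto
  finally show ?thesis .
qed

lemma measurable_szego [measurable (raw)]:
  assumes [measurable]: "f \<in> borel_measurable N"
  shows "(\<lambda>x. szego (f x)) \<in> borel_measurable N"
  unfolding szego_def by measurable

lemma borel_measurable_cnj [measurable (raw)]: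
  assumes "f \<in> borel_measurable N"
  shows "(\<lambda>x. cnj (f x)) \<in> borel_measurable N"
  using assms by (rule borel_measurable_continuous_on[OF continuous_on_cnj[OF continuous_on_id]])

lemma geometric_partial_bound:
  fixes z :: complex
  assumes "cmod z \<le> q" "q < 1"
  shows "cmod (\<Sum>k<N. z ^ k) \<le> 1 / (1 - q)"
proof -
  have q: "0 \<le> q" using assms(1) norm_ge_zero order_trans by blast
  have "cmod (\<Sum>k<N. z ^ k) \<le> (\<Sum>k<N. q ^ k)"
    by (intro sum_norm_le) (auto simp: norm_power assms intro!: power_mono)
  also have "\<dots> \<le> (\<Sum>k. q ^ k)" using q assms by (intro sum_le_suminf) (auto intro!: summable_geometric)
  also have "\<dots> = 1 / (1 - q)" using q assms by (intro suminf_geometric) auto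
  finally show ?thesis .
qed

lemma geometric_partial_tendsto:
  fixes z :: complex
  assumes "cmod z < 1"
  shows "(\<lambda>N. \<Sum>k<N. z ^ k) \<longlonglongrightarrow> 1 / (1 - z)"
  using geometric_sums[OF assms] by (simp add: sums_def)

lemma (in finite_measure) integrable_bounded:
  fixes f :: "'a \<Rightarrow> 'b::{banach,second_countable_topology}"
  shows "f \<in> borel_measurable M \<Longrightarrow> (\<And>x. norm (f x) \<le> B) \<Longrightarrow> integrable M f"
  by (rule integrable_const_bound[of _ B]) auto

lemma (in finite_measure) integral_mult_cnj_pair:
  fixes u v :: "'a \<Rightarrow> complex"
  assumes u: "u \<in> borel_measurable M" "\<And>x. norm (u x) \<le> A"
    and v: "v \<in> borel_measurable M" "\<And>x. norm (v x) \<le> B"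
  shows "integral\<^sup>L M u * cnj (integral\<^sup>L M v) = (\<integral>p. u (fst p) * cnj (v (snd p)) \<partial>(M \<Otimes>\<^sub>M M))"
proof -
  interpret P: pair_sigma_finite M M ..
  interpret PF: finite_measure "M \<Otimes>\<^sub>M M"
    by (intro finite_measure_pair_measure) unfold_locales
  note [measurable] = u(1) v(1)
  have vi: "integrable M (\<lambda>x. cnj (v x))" by (rule integrable_bounded[of _ B]) (use v in auto)
  have ui: "integrable M u" by (rule integrable_bounded[of _ A]) (use u in auto)
  have A: "A \<ge> 0" using u(2) norm_ge_zero order_trans by blast
  have "integrable (M \<Otimes>\<^sub>M M) (\<lambda>p. u (fst p) * cnj (v (snd p)))"
    by (rule PF.integrable_bounded[of _ "A * B"])
       (auto simp: norm_mult intro!: mult_mono u v A)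
  hence "(\<integral>p. u (fst p) * cnj (v (snd p)) \<partial>(M \<Otimes>\<^sub>M M)) = (\<integral>x. (\<integral>y. u x * cnj (v y) \<partial>M) \<partial>M)"
    by (subst P.integral_fst'[symmetric]) auto
  also have "\<dots> = (\<integral>x. u x * (\<integral>y. cnj (v y) \<partial>M) \<partial>M)"
    using vi by simp
  also have "\<dots> = integral\<^sup>L M u * cnj (integral\<^sup>L M v)"
    using ui by simp
  finally show ?thesis by simp
qed

text \<open>A measurable choice \<open>\<rho>\<close> of radii turns the radial maximal operator into a linear operator \<open>A\<close>,
  evaluation at \<open>\<zeta> = \<rho> e\<close>. The kernel of \<open>A A*\<close> is dominated by those of \<open>A\<close> and \<open>A*\<close>
  (see \<open>szego_mult_le\<close>), hence \<open>\<parallel>A\<parallel>\<^sup>2 \<le> C \<parallel>A\<parallel>\<close>.\<close>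

locale bessel_system = finite_measure M for M :: "'a measure" +
  fixes e :: "'a \<Rightarrow> complex" and B :: real
  assumes e_meas [measurable]: "e \<in> borel_measurable M"
    and e_norm: "\<And>x. cmod (e x) = 1"
    and B_nonneg: "B \<ge> 0"
    and bessel: "\<And>g N. g \<in> borel_measurable M \<Longrightarrow> (\<And>x. \<bar>g x\<bar> \<le> 1) \<Longrightarrow>
       (\<Sum>k<N. (cmod (\<integral>x. of_real (g x) * e x ^ k \<partial>M))\<^sup>2) \<le> B * (\<integral>x. (g x)\<^sup>2 \<partial>M)"
begin

definition moment :: "('a \<Rightarrow> real) \<Rightarrow> ('a \<Rightarrow> complex) \<Rightarrow> nat \<Rightarrow> complex" where
  "moment g \<zeta> k = (\<integral>x. of_real (g x) * \<zeta> x ^ k \<partial>M)"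

text \<open>The real part of the inner product of the moment sequences of \<open>g\<close> at
  \<open>\<zeta>\<close> and at \<open>\<eta>\<close>, with the geometric series already summed.
  Taking \<open>\<eta> = \<zeta>\<close> gives the quadratic form of \<open>A\<close> times its
  adjoint, taking \<open>\<eta> = e\<close> that of \<open>A\<close> itself.\<close>

definition energy :: "('a \<Rightarrow> real) \<Rightarrow> ('a \<Rightarrow> complex) \<Rightarrow> ('a \<Rightarrow> complex) \<Rightarrow> real" where
  "energy g \<zeta> \<eta> = (\<integral>p. g (fst p) * g (snd p) * szego (\<zeta> (fst p) * cnj (\<eta> (snd p))) \<partial>(M \<Otimes>\<^sub>M M))"

lemma energy_integrable:
  assumes [measurable]: "g \<in> borel_measurable M" "\<zeta> \<in> borel_measurable M" "\<eta> \<in> borel_measurable M"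
    and g: "\<And>x. \<bar>g x\<bar> \<le> 1" and z: "\<And>x. cmod (\<zeta> x) \<le> q" "q < 1" and h: "\<And>x. cmod (\<eta> x) \<le> 1"
  shows "integrable (M \<Otimes>\<^sub>M M) (\<lambda>p. g (fst p) * g (snd p) * szego (\<zeta> (fst p) * cnj (\<eta> (snd p))))"
proof -
  interpret PF: finite_measure "M \<Otimes>\<^sub>M M"
    by (intro finite_measure_pair_measure) unfold_locales
  have q: "q \<ge> 0" using z(1) norm_ge_zero order_trans by blast
  have zh: "cmod (\<zeta> x * cnj (\<eta> y)) \<le> q" for x y
    using mult_mono[OF z(1)[of x] h[of y] q] by (simp add: norm_mult)
  show ?thesis
  proof (rule PF.integrable_bounded[of _ "1 * 1 * (1 / (1 - q))"], measurable)
    fix p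
    show "norm (g (fst p) * g (snd p) * szego (\<zeta> (fst p) * cnj (\<eta> (snd p)))) \<le> 1 * 1 * (1 / (1 - q))"
      unfolding real_norm_def abs_mult
      by (intro mult_mono g abs_szego_le zh z) auto
  qed
qed

text \<open>By Fubini a product of moments is a double integral, and the sums over \<open>k\<close>
  are partial sums of a geometric series. They are bounded uniformly because one point stays in the
  disc of radius \<open>q < 1\<close>, so dominated convergence applies. The other point may lie on
  the circle, as is needed for \<open>\<eta> = e\<close>.\<close>

lemma energy_limit:
  assumes [measurable]: "g \<in> borel_measurable M" "\<zeta> \<in> borel_measurable M" "\<eta> \<in> borel_measurable M"
    and g: "\<And>x. \<bar>g x\<bar> \<le> 1" and z: "\<And>x. cmod (\<zeta> x) \<le> q" "q < 1" and h: "\<And>x. cmod (\<eta> x) \<le> 1"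
  shows "(\<lambda>N. Re (\<Sum>k<N. moment g \<zeta> k * cnj (moment g \<eta> k))) \<longlonglongrightarrow> energy g \<zeta> \<eta>"
proof -
  interpret PF: finite_measure "M \<Otimes>\<^sub>M M"
    by (intro finite_measure_pair_measure) unfold_locales
  have q: "q \<ge> 0" using z(1) norm_ge_zero order_trans by blast
  have zh: "cmod (\<zeta> x * cnj (\<eta> y)) \<le> q" for x y
    using mult_mono[OF z(1)[of x] h[of y] q] by (simp add: norm_mult)
  have b1: "norm (of_real (g x) * \<zeta> x ^ k :: complex) \<le> 1" for x k
    using g[of x] order.trans[OF z(1)[of x] less_imp_le[OF z(2)]]
    by (simp add: norm_mult norm_power mult_le_one power_le_one)
  have b2: "norm (of_real (g x) * \<eta> x ^ k :: complex) \<le> 1" for x k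
    using g[of x] h[of x] by (simp add: norm_mult norm_power mult_le_one power_le_one)
  let ?f = "\<lambda>N p. of_real (g (fst p) * g (snd p)) * (\<Sum>k<N. (\<zeta> (fst p) * cnj (\<eta> (snd p))) ^ k) :: complex"
  let ?F = "\<lambda>p. of_real (g (fst p) * g (snd p)) * (1 / (1 - \<zeta> (fst p) * cnj (\<eta> (snd p)))) :: complex"
  have eq: "(\<Sum>k<N. moment g \<zeta> k * cnj (moment g \<eta> k)) = (\<integral>p. ?f N p \<partial>(M \<Otimes>\<^sub>M M))" for N
  proof -
    have "moment g \<zeta> k * cnj (moment g \<eta> k) = 
       (\<integral>p. (of_real (g (fst p)) * \<zeta> (fst p) ^ k) * cnj (of_real (g (snd p)) * \<eta> (snd p) ^ k) \<partial>(M \<Otimes>\<^sub>M M))" for k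
      unfolding moment_def using b1 b2 by (intro integral_mult_cnj_pair) auto
    hence "(\<Sum>k<N. moment g \<zeta> k * cnj (moment g \<eta> k)) = 
      (\<Sum>k<N. \<integral>p. (of_real (g (fst p)) * \<zeta> (fst p) ^ k) * cnj (of_real (g (snd p)) * \<eta> (snd p) ^ k) \<partial>(M \<Otimes>\<^sub>M M))"
      by simp
    also have "\<dots> = (\<integral>p. (\<Sum>k<N. (of_real (g (fst p)) * \<zeta> (fst p) ^ k) * cnj (of_real (g (snd p)) * \<eta> (snd p) ^ k)) \<partial>(M \<Otimes>\<^sub>M M))"
    proof (rule Bochner_Integration.integral_sum[symmetric])
      fix k assume "k \<in> {..<N}"
      show "integrable (M \<Otimes>\<^sub>M M) (\<lambda>p. (of_real (g (fst p)) * \<zeta> (fst p) ^ k) * cnj (of_real (g (snd p)) * \<eta> (snd p) ^ k))"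
      proof (rule PF.integrable_bounded[of _ "1 * 1"], measurable)
        fix p 
        show "norm (of_real (g (fst p)) * \<zeta> (fst p) ^ k * cnj (of_real (g (snd p)) * \<eta> (snd p) ^ k)) \<le> 1 * 1"
          unfolding norm_mult[of "of_real (g (fst p)) * \<zeta> (fst p) ^ k"] complex_mod_cnj
          by (intro mult_mono b1 b2) auto
      qed
    qed
    also have "\<dots> = (\<integral>p. ?f N p \<partial>(M \<Otimes>\<^sub>M M))"
      by (intro Bochner_Integration.integral_cong)
         (auto simp: sum_distrib_left power_mult_distrib mult_ac intro!: sum.cong)
    finally show ?thesis .
  qed
  have "(\<lambda>N. \<integral>p. ?f N p \<partial>(M \<Otimes>\<^sub>M M)) \<longlonglongrightarrow> (\<integral>p. ?F p \<partial>(M \<Otimes>\<^sub>M M))"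
  proof (rule integral_dominated_convergence[where w = "\<lambda>_. 1 * (1 / (1 - q))"])
    show "AE p in M \<Otimes>\<^sub>M M. (\<lambda>N. ?f N p) \<longlonglongrightarrow> ?F p"
      by (intro AE_I2 tendsto_mult tendsto_const geometric_partial_tendsto le_less_trans[OF zh z(2)])
    show "AE p in M \<Otimes>\<^sub>M M. norm (?f N p) \<le> 1 * (1 / (1 - q))" for N
    proof (rule AE_I2)
      fix p
      have "\<bar>g (fst p) * g (snd p)\<bar> \<le> 1" using g by (simp add: abs_mult mult_le_one)
      thus "norm (?f N p) \<le> 1 * (1 / (1 - q))"
        unfolding norm_mult norm_of_real by (intro mult_mono geometric_partial_bound zh z) auto
    qed
    show "?F \<in> borel_measurable (M \<Otimes>\<^sub>M M)" by measurable
    show "?f N \<in> borel_measurable (M \<Otimes>\<^sub>M M)" for N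
      by (intro borel_measurable_times borel_measurable_sum borel_measurable_power) measurable
  qed simp
  hence "(\<lambda>N. Re (\<integral>p. ?f N p \<partial>(M \<Otimes>\<^sub>M M))) \<longlonglongrightarrow> Re (\<integral>p. ?F p \<partial>(M \<Otimes>\<^sub>M M))" by (rule tendsto_Re)
  also have "Re (\<integral>p. ?F p \<partial>(M \<Otimes>\<^sub>M M)) = energy g \<zeta> \<eta>"
  proof -
    have "integrable (M \<Otimes>\<^sub>M M) ?F"
    proof (rule PF.integrable_bounded[of _ "1 * (1 / (1 - q))"], measurable)
      fix p
      have "\<bar>g (fst p) * g (snd p)\<bar> \<le> 1" using g by (simp add: abs_mult mult_le_one)
      moreover have "cmod (1 / (1 - \<zeta> (fst p) * cnj (\<eta> (snd p)))) \<le> 1 / (1 - q)"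
        unfolding norm_divide norm_one
        using norm_triangle_ineq2[of 1 "\<zeta> (fst p) * cnj (\<eta> (snd p))"] zh[of "fst p" "snd p"] z(2)
        by (intro divide_left_mono mult_pos_pos) auto
      ultimately show "norm (?F p) \<le> 1 * (1 / (1 - q))"
        unfolding norm_mult[of "of_real _"] norm_of_real by (intro mult_mono) auto
    qed
    hence "Re (\<integral>p. ?F p \<partial>(M \<Otimes>\<^sub>M M)) = (\<integral>p. Re (?F p) \<partial>(M \<Otimes>\<^sub>M M))" by (rule integral_Re[symmetric])
    moreover have "Re (of_real c * w) = c * Re w" for c w by simp
    ultimately show ?thesis unfolding energy_def szego_def by (simp only:)
  qed
  finally show ?thesis unfolding eq .
qed

lemma moments_le_energy:
  assumes [measurable]: "g \<in> borel_measurable M" "\<zeta> \<in> borel_measurable M"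
    and g: "\<And>x. \<bar>g x\<bar> \<le> 1" and z: "\<And>x. cmod (\<zeta> x) \<le> q" "q < 1"
  shows "(\<Sum>k<N. (cmod (moment g \<zeta> k))\<^sup>2) \<le> energy g \<zeta> \<zeta>"
proof -
  have "cmod (\<zeta> x) \<le> 1" for x using z(1)[of x] z(2) by linarith
  hence "(\<lambda>N. Re (\<Sum>k<N. moment g \<zeta> k * cnj (moment g \<zeta> k))) \<longlonglongrightarrow> energy g \<zeta> \<zeta>"
    by (intro energy_limit[where q = q] assms)
  hence "(\<lambda>N. (\<Sum>k<N. (cmod (moment g \<zeta> k))\<^sup>2)) \<longlonglongrightarrow> energy g \<zeta> \<zeta>"
    by (simp add: complex_mult_cnj cmod_power2)
  moreover have "incseq (\<lambda>N. (\<Sum>k<N. (cmod (moment g \<zeta> k))\<^sup>2))"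
    by (intro incseq_SucI) simp
  ultimately show ?thesis by (intro incseq_le)
qed

text \<open>The bound is self-improving. With J the energy at \<open>\<zeta>\<close>,
  \<open>\<zeta>\<close> and Q the energy at \<open>\<zeta>\<close>, \<open>e\<close>, the kernel
  comparison gives J \<le> 32 Q, while Cauchy-Schwarz and the Bessel inequality give Q^2 \<le> J B G
  with G the integral of g^2. Together J^2 \<le> 1024 J B G.\<close>

lemma energy_bound:
  assumes [measurable]: "g \<in> borel_measurable M" "\<rho> \<in> borel_measurable M"
    and g: "\<And>x. \<bar>g x\<bar> \<le> 1" and r: "\<And>x. 0 \<le> \<rho> x" "\<And>x. \<rho> x \<le> q" "q < 1"
  defines "\<zeta> \<equiv> \<lambda>x. of_real (\<rho> x) * e x"
  shows "energy g \<zeta> \<zeta> \<le> 1024 * B * (\<integral>x. (g x)\<^sup>2 \<partial>M)"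
proof -
  interpret P: pair_sigma_finite M M ..
  \<comment> \<open>The comparison of kernels may be integrated only against nonnegative weights;
    passing to the absolute value leaves the integral of the square unchanged.\<close>
  define w where "w = (\<lambda>x. \<bar>g x\<bar>)"
  have [measurable]: "w \<in> borel_measurable M" unfolding w_def by measurable
  have [measurable]: "\<zeta> \<in> borel_measurable M" unfolding \<zeta>_def by measurable
  have w: "\<And>x. \<bar>w x\<bar> \<le> 1" "\<And>x. 0 \<le> w x" using g by (auto simp: w_def)
  have zn: "cmod (\<zeta> x) = \<rho> x" for x using r(1)[of x] by (simp add: \<zeta>_def norm_mult e_norm)
  have z: "cmod (\<zeta> x) \<le> q" "cmod (\<zeta> x) \<le> 1" for x using zn[of x] r(2)[of x] r(3) by linarith+
  have e1: "cmod (e x) \<le> 1" for x by (simp add: e_norm)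
  have zz: "cmod (\<zeta> x * cnj (\<zeta> y)) < 1" for x y
    using mult_mono[OF z(1)[of x] z(2)[of y]] z(1)[of x] r(3) norm_ge_zero[of "\<zeta> x"] 
    by (simp add: norm_mult)
  let ?J = "energy w \<zeta> \<zeta>" and ?Q = "energy w \<zeta> e" and ?G = "\<integral>x. (g x)\<^sup>2 \<partial>M"
  note int_zz = energy_integrable[where q = q, OF _ _ _ _ z(1) r(3) z(2)]
  note int_ze = energy_integrable[where q = q, OF _ _ _ _ z(1) r(3) e1]
  have gJ: "energy g \<zeta> \<zeta> \<le> ?J"
    unfolding energy_def
  proof (rule integral_mono)
    fix p
    have "g (fst p) * g (snd p) \<le> w (fst p) * w (snd p)" 
      unfolding w_def abs_mult[symmetric] by (rule abs_ge_self)
    thus "g (fst p) * g (snd p) * szego (\<zeta> (fst p) * cnj (\<zeta> (snd p)))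
        \<le> w (fst p) * w (snd p) * szego (\<zeta> (fst p) * cnj (\<zeta> (snd p)))"
      by (intro mult_right_mono szego_nonneg zz)
  qed (use g w in \<open>auto intro!: int_zz\<close>)
  have JQ: "?J \<le> 32 * ?Q"
  proof -
    let ?k = "\<lambda>p. w (fst p) * w (snd p) * szego (\<zeta> (fst p) * cnj (e (snd p)))"
    \<comment> \<open>The kernel of the adjoint: exchanging the two variables turns it into
      \<open>?k\<close>. Both have the same integral, so the factor 16 of
      \<open>szego_mult_le\<close> becomes 32.\<close>
    let ?k' = "\<lambda>p. w (snd p) * w (fst p) * szego (\<zeta> (snd p) * cnj (e (fst p)))"
    have km: "?k \<in> borel_measurable (M \<Otimes>\<^sub>M M)" by measurable
    have ki: "integrable (M \<Otimes>\<^sub>M M) ?k" using w by (auto intro!: int_ze)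
    have ki': "integrable (M \<Otimes>\<^sub>M M) ?k'"
      using P.integrable_product_swap[OF ki] by (simp add: case_prod_unfold)
    have sw: "integral\<^sup>L (M \<Otimes>\<^sub>M M) ?k' = integral\<^sup>L (M \<Otimes>\<^sub>M M) ?k"
      using P.integral_product_swap[OF km] by (simp add: case_prod_unfold)
    have "?J \<le> (\<integral>p. 16 * (?k p + ?k' p) \<partial>(M \<Otimes>\<^sub>M M))"
      unfolding energy_def
    proof (rule integral_mono)
      fix p
      define u where "u = e (fst p) * cnj (e (snd p))"
      have u: "cmod u = 1" by (simp add: u_def norm_mult e_norm)
      have 1: "\<zeta> (fst p) * cnj (\<zeta> (snd p)) = of_real (\<rho> (fst p)) * of_real (\<rho> (snd p)) * u"
        by (simp add: \<zeta>_def u_def mult_ac)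
      have 2: "\<zeta> (fst p) * cnj (e (snd p)) = of_real (\<rho> (fst p)) * u"
        by (simp add: \<zeta>_def u_def mult_ac)
      have 3: "cnj (\<zeta> (snd p) * cnj (e (fst p))) = of_real (\<rho> (snd p)) * u"
        by (simp add: \<zeta>_def u_def mult_ac)
      have lt: "\<rho> x < 1" for x using r(2)[of x] r(3) by linarith
      have "szego (\<zeta> (fst p) * cnj (\<zeta> (snd p))) \<le> 
          16 * (szego (\<zeta> (fst p) * cnj (e (snd p))) + szego (cnj (\<zeta> (snd p) * cnj (e (fst p)))))"
        unfolding 1 2 3 by (intro szego_mult_le r lt u)
      hence "szego (\<zeta> (fst p) * cnj (\<zeta> (snd p))) \<le> 
          16 * (szego (\<zeta> (fst p) * cnj (e (snd p))) + szego (\<zeta> (snd p) * cnj (e (fst p))))"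
        unfolding szego_cnj .
      from mult_left_mono[OF this, of "w (fst p) * w (snd p)"]
      show "w (fst p) * w (snd p) * szego (\<zeta> (fst p) * cnj (\<zeta> (snd p))) \<le> 16 * (?k p + ?k' p)"
        using w by (simp add: algebra_simps)
    qed (use w ki ki' in \<open>auto intro!: int_zz\<close>)
    also have "\<dots> = 32 * ?Q" unfolding energy_def using ki ki' sw by simp
    finally show ?thesis .
  qed
  \<comment> \<open>Cauchy-Schwarz for the two moment sequences: those at \<open>\<zeta>\<close> are
    controlled by the energy itself, those at \<open>e\<close> by the Bessel inequality.\<close>
  have QJ: "?Q\<^sup>2 \<le> ?J * (B * ?G)"
  proof -
    have "(\<lambda>N. (Re (\<Sum>k<N. moment w \<zeta> k * cnj (moment w e k)))\<^sup>2) \<longlonglongrightarrow> ?Q\<^sup>2"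
      using w e1 z r(3) by (intro tendsto_power energy_limit[where q = q]) auto
    moreover have "(Re (\<Sum>k<N. moment w \<zeta> k * cnj (moment w e k)))\<^sup>2 \<le> ?J * (B * ?G)" for N
    proof -
      have "\<bar>Re (\<Sum>k<N. moment w \<zeta> k * cnj (moment w e k))\<bar> \<le> (\<Sum>k<N. cmod (moment w \<zeta> k) * cmod (moment w e k))"
        by (rule order.trans[OF abs_Re_le_cmod sum_norm_le]) (simp add: norm_mult)
      hence "(Re (\<Sum>k<N. moment w \<zeta> k * cnj (moment w e k)))\<^sup>2 \<le> (\<Sum>k<N. cmod (moment w \<zeta> k) * cmod (moment w e k))\<^sup>2"
        by (metis abs_ge_zero power2_abs power_mono)
      also have "\<dots> \<le> (\<Sum>k<N. (cmod (moment w \<zeta> k))\<^sup>2) * (\<Sum>k<N. (cmod (moment w e k))\<^sup>2)"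
        by (rule Cauchy_Schwarz_ineq_sum)
      also have "\<dots> \<le> ?J * (B * ?G)"
      proof (rule mult_mono)
        show J: "(\<Sum>k<N. (cmod (moment w \<zeta> k))\<^sup>2) \<le> ?J" for N
          using w z r(3) by (intro moments_le_energy[where q = q]) auto
        show "?J \<ge> 0" using J[of 0] by simp
        show "(\<Sum>k<N. (cmod (moment w e k))\<^sup>2) \<le> B * ?G"
          using bessel[of w N] w unfolding moment_def by (simp add: w_def)
      qed (auto intro!: sum_nonneg)
      finally show ?thesis .
    qed
    ultimately show ?thesis by (intro LIMSEQ_le_const2) auto
  qed
  have J0: "?J \<ge> 0" using moments_le_energy[of w \<zeta> q 0] w z r(3) by simp
  have G0: "?G \<ge> 0" by simp
  \<comment> \<open>Since the radii stay below \<open>q\<close>, the kernel is bounded and the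
    energy is a genuine finite integral, so one factor of it can be cancelled. The constant is the
    square of 32.\<close>
  have "?J \<le> 1024 * B * ?G"
  proof (cases "?J = 0")
    case False
    have "?J * ?J \<le> (32 * ?Q) * (32 * ?Q)" using JQ J0 by (intro mult_mono) auto
    also have "\<dots> \<le> 1024 * (?J * (B * ?G))" using QJ by (simp add: power2_eq_square)
    finally have "?J * ?J \<le> ?J * (1024 * B * ?G)" by (simp add: mult_ac)
    thus ?thesis using False J0 by (simp add: mult_le_cancel_left)
  qed (use B_nonneg G0 in simp)
  thus ?thesis using gJ by linarith
qed

text \<open>Duality: integrating the polynomial against \<open>g\<close> pairs its coefficients with
  the moments of \<open>g\<close> at \<open>\<zeta>\<close>, and Cauchy-Schwarz leaves the energy to
  be estimated.\<close>

lemma linearised_maximal: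
  assumes [measurable]: "g \<in> borel_measurable M" "\<rho> \<in> borel_measurable M"
    and g: "\<And>x. \<bar>g x\<bar> \<le> 1" and r: "\<And>x. 0 \<le> \<rho> x" "\<And>x. \<rho> x \<le> q" "q < 1"
  shows "(\<integral>x. g x * Re (\<Sum>k<N. a k * (of_real (\<rho> x) * e x) ^ k) \<partial>M)\<^sup>2
     \<le> (\<Sum>k<N. (cmod (a k))\<^sup>2) * (1024 * B * (\<integral>x. (g x)\<^sup>2 \<partial>M))"
proof -
  define \<zeta> where "\<zeta> = (\<lambda>x. of_real (\<rho> x) * e x)"
  have [measurable]: "\<zeta> \<in> borel_measurable M" unfolding \<zeta>_def by measurable
  have zn: "cmod (\<zeta> x) = \<rho> x" for x using r(1)[of x] by (simp add: \<zeta>_def norm_mult e_norm)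
  have z: "cmod (\<zeta> x) \<le> q" "cmod (\<zeta> x) \<le> 1" for x using zn[of x] r(2)[of x] r(3) by linarith+
  have b: "norm (of_real (g x) * \<zeta> x ^ k :: complex) \<le> 1" for x k
    using g[of x] z(2)[of x] by (simp add: norm_mult norm_power mult_le_one power_le_one)
  have i: "integrable M (\<lambda>x. of_real (g x) * \<zeta> x ^ k :: complex)" for k
    by (rule integrable_bounded[of _ 1]) (use b in auto)
  have "(\<integral>x. g x * Re (\<Sum>k<N. a k * \<zeta> x ^ k) \<partial>M) = (\<integral>x. Re (\<Sum>k<N. a k * (of_real (g x) * \<zeta> x ^ k)) \<partial>M)"
    by (intro Bochner_Integration.integral_cong refl) (simp add: sum_distrib_left algebra_simps)
  also have "\<dots> = Re (\<integral>x. (\<Sum>k<N. a k * (of_real (g x) * \<zeta> x ^ k)) \<partial>M)"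
    by (intro integral_Re Bochner_Integration.integrable_sum integrable_mult_right i)
  also have "(\<integral>x. (\<Sum>k<N. a k * (of_real (g x) * \<zeta> x ^ k)) \<partial>M) = (\<Sum>k<N. a k * moment g \<zeta> k)"
    unfolding moment_def by (subst Bochner_Integration.integral_sum) (auto intro!: integrable_mult_right i)
  finally have eq: "(\<integral>x. g x * Re (\<Sum>k<N. a k * \<zeta> x ^ k) \<partial>M) = Re (\<Sum>k<N. a k * moment g \<zeta> k)" .
  have "\<bar>Re (\<Sum>k<N. a k * moment g \<zeta> k)\<bar> \<le> (\<Sum>k<N. cmod (a k) * cmod (moment g \<zeta> k))"
    by (rule order.trans[OF abs_Re_le_cmod sum_norm_le]) (simp add: norm_mult)
  hence "(Re (\<Sum>k<N. a k * moment g \<zeta> k))\<^sup>2 \<le> (\<Sum>k<N. cmod (a k) * cmod (moment g \<zeta> k))\<^sup>2"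
    by (metis abs_ge_zero power2_abs power_mono)
  also have "\<dots> \<le> (\<Sum>k<N. (cmod (a k))\<^sup>2) * (\<Sum>k<N. (cmod (moment g \<zeta> k))\<^sup>2)"
    by (rule Cauchy_Schwarz_ineq_sum)
  also have "\<dots> \<le> (\<Sum>k<N. (cmod (a k))\<^sup>2) * (1024 * B * (\<integral>x. (g x)\<^sup>2 \<partial>M))"
  proof (rule mult_left_mono)
    have "(\<Sum>k<N. (cmod (moment g \<zeta> k))\<^sup>2) \<le> energy g \<zeta> \<zeta>"
      using g z r(3) by (intro moments_le_energy[where q = q]) auto
    also have "\<dots> \<le> 1024 * B * (\<integral>x. (g x)\<^sup>2 \<partial>M)"
      unfolding \<zeta>_def using g r by (intro energy_bound[where q = q]) auto
    finally show "(\<Sum>k<N. (cmod (moment g \<zeta> k))\<^sup>2) \<le> 1024 * B * (\<integral>x. (g x)\<^sup>2 \<partial>M)" .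
  qed (auto intro!: sum_nonneg)
  finally show ?thesis unfolding eq[unfolded \<zeta>_def] unfolding \<zeta>_def .
qed

text \<open>At each point of the exceptional set a radius that witnesses the large value is
  selected, and the linearised bound is tested on the sign of that value. Finitely many radii make
  the selection measurable and keep it away from 1.\<close>

lemma weak_type_polynomial:
  fixes a :: seq and N :: nat
  assumes rs: "\<And>r. r \<in> set rs \<Longrightarrow> 0 \<le> r \<and> r < 1" and l: "l > 0"
  defines "f \<equiv> \<lambda>r x. Re (\<Sum>k<N. a k * (of_real r * e x) ^ k)"
  shows "measure M {x\<in>space M. \<exists>r\<in>set rs. \<bar>f r x\<bar> > l} \<le> 1024 * B * (\<Sum>k<N. (cmod (a k))\<^sup>2) / l\<^sup>2"
proof -
  have [measurable]: "(\<lambda>x. f r x) \<in> borel_measurable M" for r unfolding f_def by measurable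
  define E where "E = {x\<in>space M. \<exists>r\<in>set rs. \<bar>f r x\<bar> > l}"
  have E [measurable]: "E \<in> sets M" unfolding E_def by measurable
  \<comment> \<open>The selected radius is the first one in the list that exceeds the threshold, and
    0 by default.\<close>
  have "\<exists>\<rho>. \<rho> \<in> borel_measurable M \<and> (\<forall>x. \<rho> x \<in> insert 0 (set rs)) \<and>
     (\<forall>x. (\<exists>r\<in>set rs. \<bar>f r x\<bar> > l) \<longrightarrow> \<bar>f (\<rho> x) x\<bar> > l)"
  proof (induction rs)
    case Nil
    show ?case by (intro exI[of _ "\<lambda>_. 0"]) auto
  next
    case (Cons r rs)
    then obtain \<rho> where p: "\<rho> \<in> borel_measurable M" "\<forall>x. \<rho> x \<in> insert 0 (set rs)"
      "\<forall>x. (\<exists>r\<in>set rs. \<bar>f r x\<bar> > l) \<longrightarrow> \<bar>f (\<rho> x) x\<bar> > l" by blast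
    note [measurable] = p(1)
    have "(\<lambda>x. if \<bar>f r x\<bar> > l then r else \<rho> x) \<in> borel_measurable M" by measurable
    thus ?case using p(2,3) by (intro exI[of _ "\<lambda>x. if \<bar>f r x\<bar> > l then r else \<rho> x"]) auto
  qed
  then obtain \<rho> where p [measurable]: "\<rho> \<in> borel_measurable M" and p1: "\<And>x. \<rho> x \<in> insert 0 (set rs)"
    and p2: "\<And>x. (\<exists>r\<in>set rs. \<bar>f r x\<bar> > l) \<Longrightarrow> \<bar>f (\<rho> x) x\<bar> > l" by blast
  define q where "q = Max (insert 0 (set rs))"
  have pq: "\<rho> x \<le> q" for x unfolding q_def using p1[of x] by (intro Max_ge) auto
  have p0: "0 \<le> \<rho> x" for x using p1[of x] rs by auto
  have "q \<in> insert 0 (set rs)" unfolding q_def by (intro Max_in) auto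
  hence q1: "q < 1" using rs by auto
  \<comment> \<open>The extremal test function: its square is the indicator of \<open>E\<close>, and
    its product with the selected value is at least \<open>l\<close> on \<open>E\<close>.\<close>
  define g where "g = (\<lambda>x. indicator E x * sgn (f (\<rho> x) x))"
  have fm [measurable]: "(\<lambda>x. f (\<rho> x) x) \<in> borel_measurable M" unfolding f_def by measurable
  have [measurable]: "g \<in> borel_measurable M" unfolding g_def by measurable
  have g: "\<bar>g x\<bar> \<le> 1" for x by (auto simp: g_def indicator_def abs_mult sgn_real_def)
  have fl: "\<bar>f (\<rho> x) x\<bar> > l" if "x \<in> E" for x using p2 that unfolding E_def by blast
  have g2: "(\<lambda>x. (g x)\<^sup>2) = indicator E"
    using fl l by (fastforce simp: g_def indicator_def sgn_real_def)
  have gf: "l * indicator E x \<le> g x * f (\<rho> x) x" for x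
    using fl[of x] l by (auto simp: g_def indicator_def sgn_real_def)
  have fb: "\<bar>f (\<rho> x) x\<bar> \<le> (\<Sum>k<N. cmod (a k))" for x
  proof -
    have "\<bar>f (\<rho> x) x\<bar> \<le> cmod (\<Sum>k<N. a k * (of_real (\<rho> x) * e x) ^ k)"
      unfolding f_def by (rule abs_Re_le_cmod)
    also have "\<dots> \<le> (\<Sum>k<N. cmod (a k) * 1)"
    proof (intro sum_norm_le)
      fix k
      have "cmod (of_real (\<rho> x) * e x) \<le> 1" using p0[of x] pq[of x] q1 by (simp add: norm_mult e_norm)
      thus "norm (a k * (of_real (\<rho> x) * e x) ^ k) \<le> cmod (a k) * 1"
        unfolding norm_mult[of "a k"] norm_power by (intro mult_left_mono power_le_one) auto
    qed
    finally show ?thesis by simp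
  qed
  have "l * measure M E = (\<integral>x. l * indicator E x \<partial>M)" by simp
  also have "\<dots> \<le> (\<integral>x. g x * f (\<rho> x) x \<partial>M)"
  proof (rule integral_mono[OF _ _ gf])
    show "integrable M (\<lambda>x. g x * f (\<rho> x) x)"
    proof (rule integrable_bounded[of _ "1 * (\<Sum>k<N. cmod (a k))"], measurable)
      show "norm (g x * f (\<rho> x) x) \<le> 1 * (\<Sum>k<N. cmod (a k))" for x
        unfolding real_norm_def abs_mult by (intro mult_mono g fb) auto
    qed
  qed (auto intro!: integrable_bounded[of _ 1] simp: indicator_def)
  finally have le: "l * measure M E \<le> (\<integral>x. g x * f (\<rho> x) x \<partial>M)" .
  have "(l * measure M E)\<^sup>2 \<le> (\<integral>x. g x * f (\<rho> x) x \<partial>M)\<^sup>2"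
    using le l by (intro power_mono) auto
  also have "\<dots> \<le> (\<Sum>k<N. (cmod (a k))\<^sup>2) * (1024 * B * (\<integral>x. (g x)\<^sup>2 \<partial>M))"
    unfolding f_def using g p0 pq q1 by (intro linearised_maximal[where q = q]) auto
  also have "(\<integral>x. (g x)\<^sup>2 \<partial>M) = measure M E" unfolding g2 by simp
  \<comment> \<open>The measure of \<open>E\<close> occurs squared on the left and once on the
    right, so one factor is divided out.\<close>
  finally have *: "measure M E * (l\<^sup>2 * measure M E) \<le> measure M E * (1024 * B * (\<Sum>k<N. (cmod (a k))\<^sup>2))"
    by (simp add: power2_eq_square mult_ac)
  have "l\<^sup>2 * measure M E \<le> 1024 * B * (\<Sum>k<N. (cmod (a k))\<^sup>2)"
  proof (cases "measure M E = 0")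
    case True
    thus ?thesis using B_nonneg by (simp add: sum_nonneg)
  next
    case False
    hence "measure M E > 0" by (simp add: zero_less_measure_iff)
    thus ?thesis using * by (simp only: mult_le_cancel_left_pos)
  qed
  hence "measure M E \<le> 1024 * B * (\<Sum>k<N. (cmod (a k))\<^sup>2) / l\<^sup>2"
    using l by (simp add: pos_le_divide_eq mult.commute)
  thus ?thesis unfolding E_def .
qed

end

section \<open>Radial limits on the circle\<close>

definition circ :: "real measure" where
  "circ = restrict_space lborel {0..2*pi}"

lemma finite_measure_circ: "finite_measure circ"
  by (rule finite_measureI) (simp add: circ_def emeasure_restrict_space space_restrict_space)

interpretation circ: finite_measure circ
  by (rule finite_measure_circ)

lemma measure_circ_space: "measure circ (space circ) = 2 * pi"
  by (simp add: circ_def measure_restrict_space space_restrict_space)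

lemma measurable_circ: "f \<in> borel_measurable borel \<Longrightarrow> f \<in> borel_measurable circ"
  unfolding circ_def by (intro measurable_restrict_space1) simp

lemma measurable_cis [measurable]: "cis \<in> borel_measurable circ"
  by (intro measurable_circ borel_measurable_continuous_onI continuous_intros)

lemma integral_circ_cis:
  "(\<integral>s. cis (of_int m * s) \<partial>circ) = (if m = 0 then of_real (2 * pi) else 0)"
proof (cases "m = 0")
  case True
  thus ?thesis using measure_circ_space by (simp add: scaleR_conv_of_real)
next
  case False
  have "(\<integral>s. cis (of_int m * s) \<partial>circ) = (\<integral>s. indicator {0..2*pi} s *\<^sub>R cis (of_int m * s) \<partial>lborel)"
    unfolding circ_def by (rule integral_restrict_space) simp
  also have "\<dots> = cis (of_int m * (2 * pi)) / (\<i> * of_int m) - cis (of_int m * 0) / (\<i> * of_int m)"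
  proof (rule integral_FTC_atLeastAtMost)
    show "((\<lambda>s. cis (of_int m * s) / (\<i> * of_int m)) has_vector_derivative cis (of_int m * x)) (at x within {0..2*pi})" for x
    proof -
      have "((\<lambda>s. cis (of_int m * s)) has_derivative (\<lambda>h. (of_int m * h) *\<^sub>R (\<i> * cis (of_int m * x)))) (at x within {0..2*pi})"
        by (auto intro!: derivative_eq_intros)
      hence "((\<lambda>s. cis (of_int m * s)) has_vector_derivative (of_int m * \<i> * cis (of_int m * x))) (at x within {0..2*pi})"
        unfolding has_vector_derivative_def
        by (rule has_derivative_eq_rhs) (auto simp: scaleR_conv_of_real mult_ac)
      hence "((\<lambda>s. cis (of_int m * s) / (\<i> * of_int m)) has_vector_derivative
          (of_int m * \<i> * cis (of_int m * x)) / (\<i> * of_int m)) (at x within {0..2*pi})"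
        by (rule has_vector_derivative_divide)
      thus ?thesis using False by simp
    qed
    show "continuous_on {0..2*pi} (\<lambda>x. cis (of_int m * x))" by (intro continuous_intros)
  qed simp
  also have "cis (of_int m * (2 * pi)) = 1"
    using cis_multiple_2pi[of "of_int m"] by (simp add: mult_ac)
  finally show ?thesis using False by simp
qed

lemma circ_parseval_polynomial:
  "(\<integral>s. (cmod (\<Sum>k<N. d k * cis s ^ k))\<^sup>2 \<partial>circ) = 2 * pi * (\<Sum>k<N. (cmod (d k))\<^sup>2)"
proof -
  have eq: "complex_of_real ((cmod (\<Sum>k<N. d k * cis s ^ k))\<^sup>2) =
     (\<Sum>j<N. \<Sum>k<N. (d j * cnj (d k)) * cis (of_int (int j - int k) * s))" for s
  proof -
    have "d j * cis s ^ j * cnj (d k * cis s ^ k) = (d j * cnj (d k)) * cis (of_int (int j - int k) * s)" for j k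
      by (simp add: Complex.DeMoivre cis_cnj cis_mult algebra_simps)
    thus ?thesis unfolding complex_norm_square cnj_sum sum_product by (simp only:)
  qed
  have m [measurable]: "(\<lambda>s. cis (of_int m * s)) \<in> borel_measurable circ" for m
    by (intro measurable_circ borel_measurable_continuous_onI continuous_intros)
  have i: "integrable circ (\<lambda>s. c * cis (of_int m * s))" for c m
    by (rule circ.integrable_bounded[of _ "cmod c"]) (auto simp: norm_mult)
  have "complex_of_real (\<integral>s. (cmod (\<Sum>k<N. d k * cis s ^ k))\<^sup>2 \<partial>circ) =
    (\<integral>s. (\<Sum>j<N. \<Sum>k<N. (d j * cnj (d k)) * cis (of_int (int j - int k) * s)) \<partial>circ)"
    unfolding eq[symmetric] by (rule integral_complex_of_real[symmetric])
  also have "\<dots> = (\<Sum>j<N. \<Sum>k<N. (d j * cnj (d k)) * (\<integral>s. cis (of_int (int j - int k) * s) \<partial>circ))"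
    by (subst Bochner_Integration.integral_sum, intro Bochner_Integration.integrable_sum i)
       (subst Bochner_Integration.integral_sum, intro i, simp only: integral_mult_right_zero)
  also have "\<dots> = (\<Sum>j<N. \<Sum>k<N. if j = k then (d j * cnj (d k)) * of_real (2 * pi) else 0)"
    unfolding integral_circ_cis by (intro sum.cong) auto
  also have "\<dots> = (\<Sum>j<N. of_real (2 * pi * (cmod (d j))\<^sup>2))"
    by (intro sum.cong refl) (auto simp: complex_norm_square[symmetric] mult_ac)
  also have "\<dots> = of_real (2 * pi * (\<Sum>k<N. (cmod (d k))\<^sup>2))" by (simp add: sum_distrib_left)
  finally show ?thesis by (simp only: of_real_eq_iff)
qed

text \<open>As \<open>g\<close> is real, \<open>cnj (c k)\<close> is 2 pi times the
  \<open>k\<close>-th Fourier coefficient of \<open>g\<close>, so \<open>p\<close> is 2 pi times the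
  analytic part of a Fourier partial sum. The claim is that the mean square of 2 pi g - p is
  nonnegative.\<close>

lemma circ_bessel:
  assumes [measurable]: "g \<in> borel_measurable circ" and g: "\<And>x. \<bar>g x\<bar> \<le> (1::real)"
  shows "(\<Sum>k<N. (cmod (\<integral>x. of_real (g x) * cis x ^ k \<partial>circ))\<^sup>2) \<le> 2 * pi * (\<integral>x. (g x)\<^sup>2 \<partial>circ)"
proof -
  define c where "c k = (\<integral>x. of_real (g x) * cis x ^ k \<partial>circ)" for k
  define p where "p x = (\<Sum>k<N. cnj (c k) * cis x ^ k)" for x
  have [measurable]: "p \<in> borel_measurable circ" unfolding p_def by measurable
  have pb: "cmod (p x) \<le> (\<Sum>k<N. cmod (c k))" for x
    unfolding p_def by (rule sum_norm_le) (simp add: norm_mult norm_power)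
  have i1: "integrable circ (\<lambda>x. of_real (g x) * cis x ^ k :: complex)" for k
    by (rule circ.integrable_bounded[of _ 1]) (auto simp: norm_mult norm_power g)
  have i2: "integrable circ (\<lambda>x. (g x)\<^sup>2)"
    by (rule circ.integrable_bounded[of _ 1]) (auto simp: g abs_square_le_1)
  have i3: "integrable circ (\<lambda>x. g x * Re (p x))"
  proof (rule circ.integrable_bounded[of _ "1 * (\<Sum>k<N. cmod (c k))"], measurable)
    show "norm (g x * Re (p x)) \<le> 1 * (\<Sum>k<N. cmod (c k))" for x
      unfolding real_norm_def abs_mult
      by (intro mult_mono g order.trans[OF abs_Re_le_cmod pb]) auto
  qed
  have i4: "integrable circ (\<lambda>x. (cmod (p x))\<^sup>2)"
    by (rule circ.integrable_bounded[of _ "(\<Sum>k<N. cmod (c k))\<^sup>2"]) (auto intro!: power_mono pb)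
  have "(\<integral>x. g x * Re (p x) \<partial>circ) = (\<integral>x. Re (\<Sum>k<N. cnj (c k) * (of_real (g x) * cis x ^ k)) \<partial>circ)"
    unfolding p_def by (intro Bochner_Integration.integral_cong refl) (simp add: sum_distrib_left algebra_simps)
  also have "\<dots> = Re (\<integral>x. (\<Sum>k<N. cnj (c k) * (of_real (g x) * cis x ^ k)) \<partial>circ)"
    by (intro integral_Re Bochner_Integration.integrable_sum integrable_mult_right i1)
  also have "(\<integral>x. (\<Sum>k<N. cnj (c k) * (of_real (g x) * cis x ^ k)) \<partial>circ) = (\<Sum>k<N. cnj (c k) * c k)"
    unfolding c_def by (subst Bochner_Integration.integral_sum) (auto intro!: integrable_mult_right i1)
  also have "Re (\<Sum>k<N. cnj (c k) * c k) = (\<Sum>k<N. (cmod (c k))\<^sup>2)"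
    unfolding cmod_power2 by (simp add: power2_eq_square)
  finally have e3: "(\<integral>x. g x * Re (p x) \<partial>circ) = (\<Sum>k<N. (cmod (c k))\<^sup>2)" .
  have e4: "(\<integral>x. (cmod (p x))\<^sup>2 \<partial>circ) = 2 * pi * (\<Sum>k<N. (cmod (c k))\<^sup>2)"
    unfolding p_def circ_parseval_polynomial by simp
  have "0 \<le> (\<integral>x. (cmod (of_real (2 * pi * g x) - p x))\<^sup>2 \<partial>circ)" by simp
  also have "\<dots> = (\<integral>x. (4 * pi\<^sup>2) * (g x)\<^sup>2 - (4 * pi) * (g x * Re (p x)) + (cmod (p x))\<^sup>2 \<partial>circ)"
    unfolding cmod_power2
    by (intro Bochner_Integration.integral_cong refl) (simp add: power2_eq_square algebra_simps)
  also have "\<dots> = (4 * pi\<^sup>2) * (\<integral>x. (g x)\<^sup>2 \<partial>circ) - (4 * pi) * (\<Sum>k<N. (cmod (c k))\<^sup>2) + 2 * pi * (\<Sum>k<N. (cmod (c k))\<^sup>2)"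
    unfolding e3[symmetric] e4[unfolded e3[symmetric], symmetric] using i2 i3 i4 by simp
  finally have "(2 * pi) * (\<Sum>k<N. (cmod (c k))\<^sup>2) \<le> (2 * pi) * (2 * pi * (\<integral>x. (g x)\<^sup>2 \<partial>circ))"
    by (simp add: power2_eq_square)
  thus ?thesis unfolding c_def[symmetric] by (subst (asm) mult_le_cancel_left_pos) auto
qed

interpretation circ: bessel_system circ cis "2 * pi"
  by unfold_locales (auto intro!: circ_bessel)

section \<open>Power series on the disc and radial limits\<close>

lemma H2_power_series_abs_summable:
  assumes "a \<in> H2" "cmod z < 1"
  shows "summable (\<lambda>k. cmod (a k) * cmod z ^ k)"
proof (rule summable_comparison_test'[where N = 0])
  show "summable (\<lambda>k. sqrt (nsq a) * cmod z ^ k)"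
    using assms(2) by (intro summable_mult summable_geometric) simp
  show "norm (cmod (a k) * cmod z ^ k) \<le> sqrt (nsq a) * cmod z ^ k" for k
    using nsq_coord_le[OF assms(1), of k] by (auto intro!: mult_right_mono real_le_rsqrt)
qed

lemma H2_power_series_summable:
  assumes "a \<in> H2" "cmod z < 1"
  shows "summable (\<lambda>k. a k * z ^ k)"
  by (rule summable_norm_cancel) (use H2_power_series_abs_summable[OF assms] in \<open>simp add: norm_mult norm_power\<close>)

lemma seq_fun_uniform_approx:
  assumes "a \<in> H2" "0 \<le> q" "q < 1" "d > 0"
  obtains N where "\<And>z. cmod z \<le> q \<Longrightarrow> cmod (seq_fun a z - (\<Sum>k<N. a k * z ^ k)) < d"
proof -
  have sq: "summable (\<lambda>k. cmod (a k) * q ^ k)"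
    using H2_power_series_abs_summable[OF assms(1), of "of_real q"] assms by simp
  obtain N where N: "norm (\<Sum>k. cmod (a (k + N)) * q ^ (k + N)) < d"
    using suminf_exist_split[OF assms(4) sq] by blast
  have "cmod (seq_fun a z - (\<Sum>k<N. a k * z ^ k)) < d" if z: "cmod z \<le> q" for z
  proof -
    have z1: "cmod z < 1" using z assms by linarith
    have s: "summable (\<lambda>k. a k * z ^ k)" by (rule H2_power_series_summable[OF assms(1) z1])
    have sn: "summable (\<lambda>k. cmod (a (k + N) * z ^ (k + N)))"
      using summable_ignore_initial_segment[OF H2_power_series_abs_summable[OF assms(1) z1], of N]
      by (simp add: norm_mult norm_power)
    have "seq_fun a z - (\<Sum>k<N. a k * z ^ k) = (\<Sum>k. a (k + N) * z ^ (k + N))"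
      unfolding seq_fun_def using suminf_split_initial_segment[OF s, of N] by simp
    also have "cmod \<dots> \<le> (\<Sum>k. cmod (a (k + N) * z ^ (k + N)))" by (rule summable_norm[OF sn])
    also have "\<dots> \<le> (\<Sum>k. cmod (a (k + N)) * q ^ (k + N))"
      using sn summable_ignore_initial_segment[OF sq, of N] z
      by (intro suminf_le) (auto simp: norm_mult norm_power intro!: mult_left_mono power_mono)
    also have "\<dots> < d" using N by simp
    finally show ?thesis .
  qed
  thus ?thesis using that by blast
qed

lemma isCont_seq_fun:
  assumes "a \<in> H2" "cmod z < 1"
  shows "isCont (seq_fun a) z"
proof -
  define K where "K = complex_of_real ((1 + cmod z) / 2)"
  have "cmod K = (1 + cmod z) / 2" unfolding K_def norm_of_real by simp
  hence K: "cmod K < 1" "cmod z < cmod K" using assms(2) by auto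
  show ?thesis unfolding seq_fun_def[abs_def]
    by (rule isCont_powser[OF H2_power_series_summable[OF assms(1) K(1)] K(2)])
qed

lemma measurable_seq_fun [measurable]:
  "(\<lambda>s. seq_fun a (of_real r * cis s)) \<in> borel_measurable circ"
  unfolding seq_fun_def by measurable

text \<open>Up to the largest listed radius the series differs from a partial sum by less than
  \<open>l / 2\<close>, so the polynomial estimate at threshold \<open>l / 2\<close> applies. The
  constant is 1024 times the Bessel constant 2 pi, times 4 for the halved threshold.\<close>

lemma weak_type_finite:
  assumes a: "a \<in> H2" and rs: "\<And>r. r \<in> set rs \<Longrightarrow> 0 \<le> r \<and> r < 1" and l: "l > 0"
  shows "measure circ {s\<in>space circ. \<exists>r\<in>set rs. \<bar>Re (seq_fun a (of_real r * cis s))\<bar> > l} \<le> 8192 * pi * nsq a / l\<^sup>2"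
proof -
  define q where "q = Max (insert 0 (set rs))"
  have q: "r \<le> q" if "r \<in> set rs" for r unfolding q_def using that by (intro Max_ge) auto
  have "q \<in> insert 0 (set rs)" unfolding q_def by (intro Max_in) auto
  hence q01: "0 \<le> q" "q < 1" using rs by auto
  obtain N where N: "\<And>z. cmod z \<le> q \<Longrightarrow> cmod (seq_fun a z - (\<Sum>k<N. a k * z ^ k)) < l / 2"
    using seq_fun_uniform_approx[OF a q01, of "l/2"] l by auto
  let ?f = "\<lambda>r s. Re (\<Sum>k<N. a k * (of_real r * cis s) ^ k)"
  have "measure circ {s\<in>space circ. \<exists>r\<in>set rs. \<bar>Re (seq_fun a (of_real r * cis s))\<bar> > l}
     \<le> measure circ {s\<in>space circ. \<exists>r\<in>set rs. \<bar>?f r s\<bar> > l / 2}"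
  proof (rule circ.finite_measure_mono)
    show "{s \<in> space circ. \<exists>r\<in>set rs. l < \<bar>Re (seq_fun a (of_real r * cis s))\<bar>}
      \<subseteq> {s \<in> space circ. \<exists>r\<in>set rs. l / 2 < \<bar>?f r s\<bar>}"
    proof safe
      fix s r assume r: "r \<in> set rs" and gt: "l < \<bar>Re (seq_fun a (of_real r * cis s))\<bar>"
      have "cmod (of_real r * cis s) \<le> q" using q[OF r] rs[OF r] by (simp add: norm_mult)
      from N[OF this] abs_Re_le_cmod[of "seq_fun a (of_real r * cis s) - (\<Sum>k<N. a k * (of_real r * cis s) ^ k)"]
      have "\<bar>Re (seq_fun a (of_real r * cis s)) - ?f r s\<bar> < l / 2" by simp
      hence "l / 2 < \<bar>?f r s\<bar>" using gt by linarith
      thus "\<exists>r\<in>set rs. l / 2 < \<bar>?f r s\<bar>" using r by blast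
    qed
  qed measurable
  also have "\<dots> \<le> 1024 * (2 * pi) * (\<Sum>k<N. (cmod (a k))\<^sup>2) / (l / 2)\<^sup>2"
    using rs l by (intro circ.weak_type_polynomial) auto
  also have "\<dots> \<le> 1024 * (2 * pi) * nsq a / (l / 2)\<^sup>2"
    using nsq_partial_le[OF a] by (intro divide_right_mono mult_left_mono) auto
  finally show ?thesis by (simp add: power_divide mult_ac)
qed

text \<open>Continuity in the radius reduces the supremum to rational radii, and these are exhausted
  by finite lists, for which the bound is uniform.\<close>

lemma weak_type_sup:
  assumes a: "a \<in> H2" and l: "l > 0"
  defines "E \<equiv> {s\<in>space circ. \<exists>r\<in>{0..<1}. \<bar>Re (seq_fun a (of_real r * cis s))\<bar> > l}"
  shows "E \<in> sets circ" "measure circ E \<le> 8192 * pi * nsq a / l\<^sup>2"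
proof -
  define D where "D = \<rat> \<inter> {0..<(1::real)}"
  have D: "countable D" "D \<noteq> {}" unfolding D_def by (auto intro!: countable_Int1 countable_rat exI[of _ 0])
  define r where "r = from_nat_into D"
  have r01: "0 \<le> r i \<and> r i < 1" for i using from_nat_into[OF D(2), of i] by (auto simp: r_def D_def)
  define A where "A n = {s\<in>space circ. \<exists>x\<in>set (map r [0..<n]). \<bar>Re (seq_fun a (of_real x * cis s))\<bar> > l}" for n
  have Am [measurable]: "A n \<in> sets circ" for n unfolding A_def by measurable
  have EA: "E = (\<Union>n. A n)"
  proof (intro equalityI subsetI)
    fix s assume "s \<in> E"
    then obtain x where s: "s \<in> space circ" and x: "0 \<le> x" "x < 1" "\<bar>Re (seq_fun a (of_real x * cis s))\<bar> > l"
      by (auto simp: E_def)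
    have "isCont (seq_fun a) (of_real x * cis s)"
      using x by (intro isCont_seq_fun a) (simp add: norm_mult)
    \<comment> \<open>Approach from the right keeps the rational radius nonnegative even when
      \<open>x\<close> is 0.\<close>
    moreover have "((\<lambda>y. of_real y * cis s) \<longlongrightarrow> of_real x * cis s) (at_right x)"
      by (intro tendsto_intros)
    ultimately have "((\<lambda>y. seq_fun a (of_real y * cis s)) \<longlongrightarrow> seq_fun a (of_real x * cis s)) (at_right x)"
      by (rule isCont_tendsto_compose)
    hence "((\<lambda>y. \<bar>Re (seq_fun a (of_real y * cis s))\<bar>) \<longlongrightarrow> \<bar>Re (seq_fun a (of_real x * cis s))\<bar>) (at_right x)"
      by (intro tendsto_rabs tendsto_Re)
    hence "eventually (\<lambda>y. l < \<bar>Re (seq_fun a (of_real y * cis s))\<bar>) (at_right x)"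
      using x(3) by (rule order_tendstoD(1))
    then obtain b where b: "b > x" "\<And>y. x < y \<Longrightarrow> y < b \<Longrightarrow> l < \<bar>Re (seq_fun a (of_real y * cis s))\<bar>"
      unfolding eventually_at_right_field by blast
    obtain y where y: "y \<in> \<rat>" "x < y" "y < min b 1"
      using Rats_dense_in_real[of x "min b 1"] b(1) x(2) by auto
    hence "y \<in> D" using x by (auto simp: D_def)
    then obtain i where "y = r i" unfolding r_def using from_nat_into_surj[OF D(1)] by metis
    hence "s \<in> A (Suc i)" unfolding A_def using s b(2)[of y] y by (auto intro!: bexI[of _ i])
    thus "s \<in> (\<Union>n. A n)" by blast
  next
    fix s assume "s \<in> (\<Union>n. A n)"
    thus "s \<in> E" using r01 unfolding A_def E_def by fastforce
  qed
  show "E \<in> sets circ" unfolding EA by measurable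
  have "incseq A" unfolding A_def by (intro incseq_SucI) auto
  hence "(\<lambda>n. measure circ (A n)) \<longlonglongrightarrow> measure circ (\<Union>n. A n)"
    by (intro circ.finite_Lim_measure_incseq) auto
  moreover have "measure circ (A n) \<le> 8192 * pi * nsq a / l\<^sup>2" for n
    unfolding A_def by (rule weak_type_finite[OF a _ l]) (use r01 in auto)
  ultimately show "measure circ E \<le> 8192 * pi * nsq a / l\<^sup>2"
    unfolding EA by (intro LIMSEQ_le_const2) auto
qed

text \<open>A point where the claim fails lies in \<open>E N\<close> for every \<open>N\<close>, and
  the measures of these sets are bounded by the squared norms of the tails, which tend to 0.\<close>

lemma AE_tail_small_Re:
  assumes a: "a \<in> H2" and l: "l > 0"
  shows "AE s in circ. \<exists>N. \<forall>r\<in>{0..<1}. \<bar>Re (seq_fun (\<lambda>k. a k - trunc N a k) (of_real r * cis s))\<bar> \<le> l"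
proof -
  let ?t = "\<lambda>N k. a k - trunc N a k"
  define E where "E N = {s\<in>space circ. \<exists>r\<in>{0..<1}. \<bar>Re (seq_fun (?t N) (of_real r * cis s))\<bar> > l}" for N
  have tH: "?t N \<in> H2" for N by (intro H2_diff a H2_trunc)
  note w = weak_type_sup[OF tH l, folded E_def]
  have "(\<lambda>N. 8192 * pi * nsq (?t N) / l\<^sup>2) \<longlonglongrightarrow> 8192 * pi * 0 / l\<^sup>2"
    using l by (intro tendsto_intros nsq_diff_trunc_tendsto a) auto
  moreover have "measure circ (\<Inter>N. E N) \<le> 8192 * pi * nsq (?t N) / l\<^sup>2" for N
  proof -
    have "measure circ (\<Inter>N. E N) \<le> measure circ (E N)"
      using w(1)[of N] by (intro circ.finite_measure_mono) auto
    also have "\<dots> \<le> 8192 * pi * nsq (?t N) / l\<^sup>2" by (rule w(2))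
    finally show ?thesis .
  qed
  ultimately have "measure circ (\<Inter>N. E N) \<le> 8192 * pi * 0 / l\<^sup>2"
    by (intro LIMSEQ_le_const) auto
  hence "measure circ (\<Inter>N. E N) = 0" using measure_nonneg[of circ "\<Inter>N. E N"] by (simp add: antisym)
  hence "(\<Inter>N. E N) \<in> null_sets circ"
    using w(1) by (auto intro!: null_setsI simp: circ.emeasure_eq_measure)
  thus ?thesis
    by (rule AE_I') (auto simp: E_def not_le)
qed

text \<open>The Moore-Osgood exchange of limits: the limits \<open>L n\<close> are Cauchy because
  \<open>h m\<close> and \<open>h n\<close> both lie uniformly close to \<open>f\<close>.\<close>

lemma tendsto_at_left_uniform_approx:
  fixes f :: "real \<Rightarrow> complex"
  assumes "\<And>n. (h n \<longlongrightarrow> L n) (at_left 1)"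
    and le: "\<And>n r. 0 \<le> r \<Longrightarrow> r < 1 \<Longrightarrow> cmod (f r - h n r) \<le> d n"
    and d: "d \<longlonglongrightarrow> 0"
  shows "\<exists>l. (f \<longlongrightarrow> l) (at_left 1)"
proof -
  have ev: "eventually (\<lambda>r. 0 \<le> r \<and> r < (1::real)) (at_left 1)"
    unfolding eventually_at_left_field by (intro exI[of _ 0]) auto
  have LL: "cmod (L m - L n) \<le> d m + d n" for m n
  proof (rule tendsto_upperbound)
    show "((\<lambda>r. cmod (h m r - h n r)) \<longlongrightarrow> cmod (L m - L n)) (at_left 1)"
      by (intro tendsto_intros assms)
    show "eventually (\<lambda>r. cmod (h m r - h n r) \<le> d m + d n) (at_left 1)"
      using ev
    proof eventually_elim
      case (elim r)
      have "cmod (h m r - h n r) \<le> cmod (f r - h m r) + cmod (f r - h n r)"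
        using norm_triangle_ineq4[of "f r - h n r" "f r - h m r"] by simp
      thus ?case using le[of r m] le[of r n] elim by linarith
    qed
  qed simp
  have "Cauchy L"
  proof (rule metric_CauchyI)
    fix x :: real assume "x > 0"
    hence "eventually (\<lambda>n. d n < x / 2) sequentially" using d by (intro order_tendstoD) auto
    then obtain K where K: "\<And>n. n \<ge> K \<Longrightarrow> d n < x / 2" by (auto simp: eventually_sequentially)
    have "dist (L m) (L n) < x" if "m \<ge> K" "n \<ge> K" for m n
      using LL[of m n] K[OF that(1)] K[OF that(2)] unfolding dist_norm by linarith
    thus "\<exists>K. \<forall>m\<ge>K. \<forall>n\<ge>K. dist (L m) (L n) < x" by blast
  qed
  then obtain l where l: "L \<longlonglongrightarrow> l" using Cauchy_convergent convergent_def by blast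
  have ul: "uniform_limit {0..<1} h f sequentially"
  proof (rule uniform_limitI)
    fix x :: real assume "x > 0"
    hence "eventually (\<lambda>n. d n < x) sequentially" using d by (intro order_tendstoD) auto
    thus "eventually (\<lambda>n. \<forall>r\<in>{0..<1}. dist (h n r) (f r) < x) sequentially"
    proof eventually_elim
      case (elim n)
      show ?case
      proof
        fix r :: real assume "r \<in> {0..<1}"
        thus "dist (h n r) (f r) < x" using le[of r n] elim by (simp add: dist_norm norm_minus_commute)
      qed
    qed
  qed
  have at: "at (1::real) within {0..<1} = at_left 1"
    by (rule at_within_nhd[of _ "{0<..}"]) auto
  have "(f \<longlongrightarrow> l) (at 1 within {0..<1})"
    by (rule swap_uniform_limit[OF _ l ul]) (use assms(1) in \<open>auto simp: at\<close>)
  thus ?thesis unfolding at by blast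
qed

text \<open>Polynomials have radial limits at every point, and almost everywhere the tails are
  uniformly small along the whole radius.\<close>

theorem fatou_radial_limits:
  assumes a: "a \<in> H2"
  shows "AE s in circ. \<exists>L. ((\<lambda>r. seq_fun a (of_real r * cis s)) \<longlongrightarrow> L) (at_left 1)"
proof -
  \<comment> \<open>The maximal estimate concerns real parts; the real part of the function of
    \<open>b\<close> is the imaginary part of that of \<open>a\<close>.\<close>
  define b where "b = (\<lambda>k. - \<i> * a k)"
  have bH: "b \<in> H2" unfolding b_def by (rule H2_scale[OF a])
  have "AE s in circ. \<forall>m. \<exists>N. \<forall>r\<in>{0..<1}.
     \<bar>Re (seq_fun (\<lambda>k. a k - trunc N a k) (of_real r * cis s))\<bar> \<le> inverse (real (Suc m))"
    unfolding AE_all_countable by (intro allI AE_tail_small_Re a) simp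
  moreover have "AE s in circ. \<forall>m. \<exists>N. \<forall>r\<in>{0..<1}.
     \<bar>Re (seq_fun (\<lambda>k. b k - trunc N b k) (of_real r * cis s))\<bar> \<le> inverse (real (Suc m))"
    unfolding AE_all_countable by (intro allI AE_tail_small_Re bH) simp
  ultimately show ?thesis
  proof eventually_elim
    case (elim s)
    obtain N where N: "\<And>m r. 0 \<le> r \<Longrightarrow> r < 1 \<Longrightarrow>
       \<bar>Re (seq_fun (\<lambda>k. a k - trunc (N m) a k) (of_real r * cis s))\<bar> \<le> inverse (real (Suc m))"
      using elim(1) by (simp add: Ball_def) metis
    obtain K where K: "\<And>m r. 0 \<le> r \<Longrightarrow> r < 1 \<Longrightarrow>
       \<bar>Re (seq_fun (\<lambda>k. b k - trunc (K m) b k) (of_real r * cis s))\<bar> \<le> inverse (real (Suc m))"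
      using elim(2) by (simp add: Ball_def) metis
    define P where "P n z = (\<Sum>k<n. a k * z ^ k)" for n z
    have split: "seq_fun (\<lambda>k. c k - trunc n c k) z = seq_fun c z - (\<Sum>k<n. c k * z ^ k)"
      if "c \<in> H2" "cmod z < 1" for c n z
    proof -
      have "(\<lambda>k. trunc n c k * z ^ k) sums (\<Sum>k<n. trunc n c k * z ^ k)"
        by (intro sums_finite) (auto simp: trunc_def)
      hence "(\<lambda>k. c k * z ^ k - trunc n c k * z ^ k) sums (seq_fun c z - (\<Sum>k<n. trunc n c k * z ^ k))"
        unfolding seq_fun_def by (intro sums_diff summable_sums H2_power_series_summable that)
      thus ?thesis unfolding seq_fun_def[of "\<lambda>k. c k - trunc n c k"]
        by (simp add: sums_iff algebra_simps trunc_def)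
    qed
    have bfun: "seq_fun b z = - \<i> * seq_fun a z" if "cmod z < 1" for z
      unfolding seq_fun_def b_def
      using suminf_mult[OF H2_power_series_summable[OF a that], of "- \<i>"] by (simp add: mult.assoc)
    \<comment> \<open>The truncation orders \<open>N m\<close> and \<open>K m\<close> for the two
      parts are unrelated, so the approximant combines the real part of one partial sum with the
      imaginary part of another.\<close>
    define h where "h m r = complex_of_real (Re (P (N m) (of_real r * cis s))) + \<i> * complex_of_real (Im (P (K m) (of_real r * cis s)))" for m r
    show ?case
    proof (rule tendsto_at_left_uniform_approx)
      show "(h m \<longlongrightarrow> h m 1) (at_left 1)" for m
        unfolding h_def P_def by (intro tendsto_intros)
      show "(\<lambda>m. 2 * inverse (real (Suc m))) \<longlonglongrightarrow> 0"
        using tendsto_mult_right_zero[OF LIMSEQ_inverse_real_of_nat] by simp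
      fix m :: nat and r :: real assume r: "0 \<le> r" "r < 1"
      have z: "cmod (of_real r * cis s) < 1" using r by (simp add: norm_mult)
      have 1: "\<bar>Re (seq_fun a (of_real r * cis s) - P (N m) (of_real r * cis s))\<bar> \<le> inverse (real (Suc m))"
        using N[OF r, of m] unfolding split[OF a z] P_def .
      have "(\<Sum>k<K m. b k * (of_real r * cis s) ^ k) = - \<i> * P (K m) (of_real r * cis s)"
        unfolding P_def b_def by (simp add: sum_distrib_left mult.assoc)
      hence "seq_fun b (of_real r * cis s) - (\<Sum>k<K m. b k * (of_real r * cis s) ^ k) = 
         - \<i> * (seq_fun a (of_real r * cis s) - P (K m) (of_real r * cis s))"
        unfolding bfun[OF z] by (simp add: algebra_simps)
      hence 2: "\<bar>Im (seq_fun a (of_real r * cis s) - P (K m) (of_real r * cis s))\<bar> \<le> inverse (real (Suc m))"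
        using K[OF r, of m] unfolding split[OF bH z] by simp
      have "cmod (seq_fun a (of_real r * cis s) - h m r) \<le> 
         \<bar>Re (seq_fun a (of_real r * cis s) - h m r)\<bar> + \<bar>Im (seq_fun a (of_real r * cis s) - h m r)\<bar>"
        by (rule cmod_le)
      also have "\<dots> \<le> 2 * inverse (real (Suc m))"
        using 1 2 by (simp add: h_def)
      finally show "cmod (seq_fun a (of_real r * cis s) - h m r) \<le> 2 * inverse (real (Suc m))" .
    qed
  qed
qed

section \<open>Inner functions and the theorem of Beurling\<close>

text \<open>Parseval for partial sums on the circle of radius \<open>r\<close>, with the number of
  terms sent to infinity by dominated convergence. Keeping a finite \<open>K\<close> on the left
  allows \<open>r\<close> to tend to 1 term by term afterwards.\<close>

lemma circ_mean_ge:
  assumes t: "t \<in> H2" and r: "0 \<le> r" "r < 1"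
  shows "2 * pi * (\<Sum>k<K. (cmod (t k))\<^sup>2 * r ^ (2 * k)) \<le> (\<integral>s. (cmod (seq_fun t (of_real r * cis s)))\<^sup>2 \<partial>circ)"
proof -
  define W where "W = (\<Sum>k. cmod (t k) * r ^ k)"
  have sW: "summable (\<lambda>k. cmod (t k) * r ^ k)"
    using H2_power_series_abs_summable[OF t, of "of_real r"] r by simp
  let ?X = "\<lambda>N s. (cmod (\<Sum>k<N. t k * (of_real r * cis s) ^ k))\<^sup>2"
  have lim: "(\<lambda>N. \<integral>s. ?X N s \<partial>circ) \<longlonglongrightarrow> (\<integral>s. (cmod (seq_fun t (of_real r * cis s)))\<^sup>2 \<partial>circ)"
  proof (rule integral_dominated_convergence[where w = "\<lambda>_. W\<^sup>2"])
    show "AE s in circ. (\<lambda>N. ?X N s) \<longlonglongrightarrow> (cmod (seq_fun t (of_real r * cis s)))\<^sup>2"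
    proof (rule AE_I2)
      fix s
      have "cmod (of_real r * cis s) < 1" using r by (simp add: norm_mult)
      hence "(\<lambda>N. \<Sum>k<N. t k * (of_real r * cis s) ^ k) \<longlonglongrightarrow> seq_fun t (of_real r * cis s)"
        unfolding seq_fun_def by (intro summable_LIMSEQ H2_power_series_summable t)
      thus "(\<lambda>N. ?X N s) \<longlonglongrightarrow> (cmod (seq_fun t (of_real r * cis s)))\<^sup>2"
        by (intro tendsto_power tendsto_norm)
    qed
    show "AE s in circ. norm (?X N s) \<le> W\<^sup>2" for N
    proof (rule AE_I2)
      fix s
      have "cmod (\<Sum>k<N. t k * (of_real r * cis s) ^ k) \<le> (\<Sum>k<N. cmod (t k) * r ^ k)"
        using r by (intro sum_norm_le) (simp add: norm_mult norm_power)
      also have "\<dots> \<le> W" unfolding W_def using r sW by (intro sum_le_suminf) auto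
      finally show "norm (?X N s) \<le> W\<^sup>2" by (simp add: power_mono)
    qed
    show "(\<lambda>s. (cmod (seq_fun t (of_real r * cis s)))\<^sup>2) \<in> borel_measurable circ" by measurable
    show "?X N \<in> borel_measurable circ" for N by measurable
  qed simp
  have eq: "(\<integral>s. ?X N s \<partial>circ) = 2 * pi * (\<Sum>k<N. (cmod (t k))\<^sup>2 * r ^ (2 * k))" for N
  proof -
    have "(\<integral>s. ?X N s \<partial>circ) = (\<integral>s. (cmod (\<Sum>k<N. (t k * of_real r ^ k) * cis s ^ k))\<^sup>2 \<partial>circ)"
      by (simp add: power_mult_distrib mult.assoc)
    also have "\<dots> = 2 * pi * (\<Sum>k<N. (cmod (t k * of_real r ^ k))\<^sup>2)" by (rule circ_parseval_polynomial)
    also have "(\<Sum>k<N. (cmod (t k * of_real r ^ k))\<^sup>2) = (\<Sum>k<N. (cmod (t k))\<^sup>2 * r ^ (2 * k))"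
      using r by (intro sum.cong refl)
        (simp add: norm_mult norm_power power_mult_distrib power_mult[symmetric] mult.commute)
    finally show ?thesis .
  qed
  show ?thesis
  proof (rule LIMSEQ_le_const[OF lim], intro exI allI impI)
    fix N assume "N \<ge> K"
    thus "2 * pi * (\<Sum>k<K. (cmod (t k))\<^sup>2 * r ^ (2 * k)) \<le> (\<integral>s. ?X N s \<partial>circ)"
      unfolding eq using r by (intro mult_left_mono sum_mono2) auto
  qed
qed

text \<open>The boundary function has modulus at most 1, yet its mean square is at least the squared
  norm, which is 1. The nonnegative function 1 - |L|^2 therefore has integral 0 and vanishes almost
  everywhere.\<close>

lemma inner_fnI:
  assumes t: "t \<in> H2" "nsq t = 1" and bd: "\<And>z. cmod z < 1 \<Longrightarrow> cmod (seq_fun t z) \<le> 1"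
  shows "inner_fn t"
proof -
  define r where "r j = 1 - inverse (real (Suc j))" for j
  have r01: "0 \<le> r j" "r j < 1" for j by (auto simp: r_def field_simps)
  have r1: "r \<longlonglongrightarrow> 1"
    unfolding r_def using tendsto_diff[OF tendsto_const LIMSEQ_inverse_real_of_nat, of 1] by simp
  have rl: "filterlim r (at_left 1) sequentially"
    using r1 r01 by (intro filterlim_at_withinI) (auto simp: less_imp_neq)
  define X where "X j s = seq_fun t (of_real (r j) * cis s)" for j s
  have Xm [measurable]: "X j \<in> borel_measurable circ" for j unfolding X_def by measurable
  \<comment> \<open>Defined along a sequence of radii, the boundary function is measurable; it
    agrees with the radial limit wherever that exists.\<close>
  define L where "L s = lim (\<lambda>j. X j s)" for s
  have Lm [measurable]: "L \<in> borel_measurable circ" unfolding L_def by measurable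
  have Xb: "cmod (X j s) \<le> 1" for j s
    unfolding X_def using r01[of j] by (intro bd) (simp add: norm_mult)
  have lims: "AE s in circ. ((\<lambda>r. seq_fun t (of_real r * cis s)) \<longlongrightarrow> L s) (at_left 1)"
    using fatou_radial_limits[OF t(1)]
  proof eventually_elim
    case (elim s)
    then obtain l where l: "((\<lambda>r. seq_fun t (of_real r * cis s)) \<longlongrightarrow> l) (at_left 1)" by blast
    hence "(\<lambda>j. X j s) \<longlonglongrightarrow> l" unfolding X_def by (rule filterlim_compose[OF _ rl])
    hence "L s = l" unfolding L_def by (rule limI)
    thus ?case using l by simp
  qed
  hence XL: "AE s in circ. (\<lambda>j. X j s) \<longlonglongrightarrow> L s"
    unfolding X_def by eventually_elim (rule filterlim_compose[OF _ rl])
  have Lb: "AE s in circ. cmod (L s) \<le> 1"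
    using XL
  proof eventually_elim
    case (elim s)
    thus ?case using Xb by (intro LIMSEQ_le_const2[OF tendsto_norm]) auto
  qed
  have lim: "(\<lambda>j. \<integral>s. (cmod (X j s))\<^sup>2 \<partial>circ) \<longlonglongrightarrow> (\<integral>s. (cmod (L s))\<^sup>2 \<partial>circ)"
  proof (rule integral_dominated_convergence[where w = "\<lambda>_. 1"])
    show "AE s in circ. (\<lambda>j. (cmod (X j s))\<^sup>2) \<longlonglongrightarrow> (cmod (L s))\<^sup>2"
      using XL by eventually_elim (intro tendsto_power tendsto_norm)
    show "AE s in circ. norm ((cmod (X j s))\<^sup>2) \<le> 1" for j
      using Xb by (auto simp: abs_square_le_1)
  qed auto
  have "2 * pi * (\<Sum>k<K. (cmod (t k))\<^sup>2) \<le> (\<integral>s. (cmod (L s))\<^sup>2 \<partial>circ)" for K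
  proof (rule LIMSEQ_le[OF _ lim])
    have "(\<lambda>j. 2 * pi * (\<Sum>k<K. (cmod (t k))\<^sup>2 * r j ^ (2 * k))) \<longlonglongrightarrow> 2 * pi * (\<Sum>k<K. (cmod (t k))\<^sup>2 * 1 ^ (2 * k))"
      by (intro tendsto_intros r1)
    thus "(\<lambda>j. 2 * pi * (\<Sum>k<K. (cmod (t k))\<^sup>2 * r j ^ (2 * k))) \<longlonglongrightarrow> 2 * pi * (\<Sum>k<K. (cmod (t k))\<^sup>2)" by simp
    show "\<exists>N. \<forall>j\<ge>N. 2 * pi * (\<Sum>k<K. (cmod (t k))\<^sup>2 * r j ^ (2 * k)) \<le> (\<integral>s. (cmod (X j s))\<^sup>2 \<partial>circ)"
      unfolding X_def using circ_mean_ge[OF t(1) r01] by blast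
  qed
  moreover have "(\<lambda>K. 2 * pi * (\<Sum>k<K. (cmod (t k))\<^sup>2)) \<longlonglongrightarrow> 2 * pi * nsq t"
    unfolding nsq_def by (intro tendsto_mult tendsto_const summable_LIMSEQ H2_summable t)
  ultimately have ge: "2 * pi \<le> (\<integral>s. (cmod (L s))\<^sup>2 \<partial>circ)"
    using t(2) by (intro LIMSEQ_le_const2) auto
  have Lb': "AE s in circ. (cmod (L s))\<^sup>2 \<le> 1" using Lb by eventually_elim (simp add: abs_square_le_1)
  have iL: "integrable circ (\<lambda>s. (cmod (L s))\<^sup>2)"
    using Lb' by (intro circ.integrable_const_bound[of _ 1]) auto
  hence iD: "integrable circ (\<lambda>s. 1 - (cmod (L s))\<^sup>2)" by simp
  have nn: "AE s in circ. 0 \<le> 1 - (cmod (L s))\<^sup>2" using Lb' by eventually_elim simp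
  have "(\<integral>s. 1 - (cmod (L s))\<^sup>2 \<partial>circ) = 2 * pi - (\<integral>s. (cmod (L s))\<^sup>2 \<partial>circ)"
    using iL measure_circ_space by simp
  hence "(\<integral>s. 1 - (cmod (L s))\<^sup>2 \<partial>circ) = 0"
    using ge integral_nonneg_AE[OF nn] by linarith
  hence "AE s in circ. 1 - (cmod (L s))\<^sup>2 = 0"
    using integral_nonneg_eq_0_iff_AE[OF iD nn] by blast
  hence "AE s in circ. \<exists>l. cmod l = 1 \<and> ((\<lambda>r. seq_fun t (of_real r * cis s)) \<longlongrightarrow> l) (at_left 1)"
    using lims
  proof eventually_elim
    case (elim s)
    have "(cmod (L s))\<^sup>2 = 1\<^sup>2" using elim(1) by simp
    hence "cmod (L s) = 1" by (subst (asm) power2_eq_iff_nonneg) auto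
    thus ?case using elim(2) by blast
  qed
  hence "AE s in lborel. s \<in> {0..2*pi} \<longrightarrow> (\<exists>l. cmod l = 1 \<and> ((\<lambda>r. seq_fun t (of_real r * cis s)) \<longlongrightarrow> l) (at_left 1))"
    unfolding circ_def by (subst (asm) AE_restrict_space_iff) auto
  hence "AE s in lebesgue. s \<in> {0..2*pi} \<longrightarrow> (\<exists>l. cmod l = 1 \<and> ((\<lambda>r. seq_fun t (of_real r * cis s)) \<longlongrightarrow> l) (at_left 1))"
    by (rule AE_completion)
  moreover have "t \<in> Hinf" unfolding Hinf_def using H2_power_series_summable[OF t(1)] bd by blast
  ultimately show ?thesis unfolding inner_fn_def by blast
qed

section \<open>Shifts and Cauchy products\<close>

lemma zshift_zshift: "zshift j (zshift k a) = zshift (j + k) a"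
  by (auto simp: zshift_def fun_eq_iff)

lemma zshift_0 [simp]: "zshift 0 a = a"
  by (simp add: zshift_def)

lemma Mz_eq_zshift: "Mz a = zshift 1 a"
  by (auto simp: Mz_def zshift_def fun_eq_iff)

lemma zshift_add [simp]: "zshift m a (k + m) = a k"
  by (simp add: zshift_def)

lemma zshift_less: "k < m \<Longrightarrow> zshift m a k = 0"
  by (simp add: zshift_def)

lemma zshift_H2_iff: "zshift m a \<in> H2 \<longleftrightarrow> a \<in> H2"
  unfolding H2_def using summable_iff_shift[of "\<lambda>k. (cmod (zshift m a k))\<^sup>2" m] by simp

lemma zshift_zH2: "a \<in> zH2 k \<Longrightarrow> zshift m a \<in> zH2 (m + k)"
  unfolding zH2_def by (auto simp: zshift_H2_iff) (auto simp: zshift_def)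

lemma h2_inner_zshift:
  assumes "a \<in> H2" "b \<in> H2"
  shows "h2_inner (zshift m a) (zshift m b) = h2_inner a b"
proof -
  have "(\<lambda>k. zshift m a (k + m) * cnj (zshift m b (k + m))) sums h2_inner a b"
    unfolding h2_inner_def using h2_inner_summable[OF assms] by (simp add: summable_sums)
  hence "(\<lambda>k. zshift m a k * cnj (zshift m b k)) sums (h2_inner a b + (\<Sum>k<m. zshift m a k * cnj (zshift m b k)))"
    by (subst (asm) sums_iff_shift)
  thus ?thesis unfolding h2_inner_def[of "zshift m a"] by (simp add: sums_iff zshift_less)
qed

lemma nsq_zshift:
  assumes "a \<in> H2"
  shows "nsq (zshift m a) = nsq a"
  using h2_inner_zshift[OF assms assms, of m] assms by (simp add: h2_inner_self zshift_H2_iff)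

lemma zshift_diff: "zshift m (\<lambda>k. a k - b k) = (\<lambda>k. zshift m a k - zshift m b k)"
  by (auto simp: zshift_def)

lemma cprod_commute: "cprod a b = cprod b a"
proof
  fix n
  show "cprod a b n = cprod b a n" unfolding cprod_def
    by (rule sum.reindex_bij_witness[of _ "\<lambda>k. n - k" "\<lambda>k. n - k"]) (auto simp: mult.commute)
qed

lemma cprod_diff_right: "cprod t (\<lambda>k. a k - b k) = (\<lambda>n. cprod t a n - cprod t b n)"
  by (auto simp: cprod_def algebra_simps sum_subtractf)

lemma cprod_zshift_right: "cprod t (zshift m h) = zshift m (cprod t h)"
proof
  fix n
  show "cprod t (zshift m h) n = zshift m (cprod t h) n"
  proof (cases "n < m")
    case True
    hence "n - k < m" for k by simp
    thus ?thesis using True by (simp add: cprod_def zshift_def)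
  next
    case False
    have "cprod t (zshift m h) n = (\<Sum>k\<le>n. t k * zshift m h (n - k))" by (simp add: cprod_def)
    also have "\<dots> = (\<Sum>k\<le>n - m. t k * h (n - m - k))"
      using False by (intro sum.mono_neutral_cong_right) (auto simp: zshift_def add.commute)
    finally show ?thesis using False by (simp add: cprod_def zshift_def)
  qed
qed

lemma cprod_trunc: "cprod t (trunc N h) = (\<lambda>k. \<Sum>j<N. h j * zshift j t k)"
proof
  fix n
  have "cprod t (trunc N h) n = (\<Sum>j\<le>n. trunc N h j * t (n - j))"
    unfolding cprod_commute[of t] by (simp add: cprod_def)
  also have "\<dots> = (\<Sum>j\<in>{..n} \<inter> {..<N}. h j * t (n - j))"
    by (intro sum.mono_neutral_cong_right) (auto simp: trunc_def)
  also have "\<dots> = (\<Sum>j<N. h j * zshift j t n)"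
    by (intro sum.mono_neutral_cong_left) (auto simp: zshift_def)
  finally show "cprod t (trunc N h) n = (\<Sum>j<N. h j * zshift j t n)" .
qed

text \<open>A coefficient of the product depends on finitely many coefficients of \<open>h\<close>,
  so estimates for finite combinations of shifts of \<open>t\<close> extend to every
  \<open>h\<close> in \<open>H2\<close>.\<close>

lemma cprod_local: "k < N \<Longrightarrow> cprod t (trunc N h) k = cprod t h k"
  unfolding cprod_def by (intro sum.cong) (auto simp: trunc_def)

lemma H2_sum:
  assumes "finite A" "\<And>i. i \<in> A \<Longrightarrow> f i \<in> H2"
  shows "(\<lambda>k. \<Sum>i\<in>A. c i * f i k) \<in> H2"
  using assms
proof (induction A rule: finite_induct)
  case (insert i A)
  have "(\<lambda>k. (\<Sum>i\<in>A. c i * f i k) + c i * f i k) \<in> H2"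
    by (rule H2_add_scale) (use insert in auto)
  thus ?case using insert by (simp add: add.commute)
qed (simp add: H2_zero)

lemma h2_inner_sum:
  assumes "finite A" "\<And>i. i \<in> A \<Longrightarrow> f i \<in> H2" "d \<in> H2"
  shows "h2_inner (\<lambda>k. \<Sum>i\<in>A. c i * f i k) d = (\<Sum>i\<in>A. c i * h2_inner (f i) d)"
  using assms(1,2)
proof (induction A rule: finite_induct)
  case (insert i A)
  have "h2_inner (\<lambda>k. (\<Sum>i\<in>A. c i * f i k) + c i * f i k) d = h2_inner (\<lambda>k. \<Sum>i\<in>A. c i * f i k) d + c i * h2_inner (f i) d"
    by (rule h2_inner_add_scale) (use insert assms(3) in \<open>auto intro!: H2_sum\<close>)
  thus ?case using insert by (simp add: add.commute)
qed simp

text \<open>A unit wandering vector for the shift. This is the Hilbert space counterpart of being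
  inner: the inner products of the shifts of \<open>t\<close> with \<open>t\<close> are the Fourier
  coefficients of |t|^2 on the circle.\<close>

locale wandering_unit =
  fixes t :: seq
  assumes t_H2: "t \<in> H2" and t_norm: "nsq t = 1"
    and t_orth: "\<And>k. k \<ge> 1 \<Longrightarrow> h2_inner (zshift k t) t = 0"
begin

lemma orthonormal: "h2_inner (zshift i t) (zshift j t) = (if i = j then 1 else 0)"
proof -
  have *: "h2_inner (zshift (j + k) t) (zshift j t) = 0" if "k \<ge> 1" for j k
    using h2_inner_zshift[of "zshift k t" t j] t_orth[OF that] t_H2
    by (simp add: zshift_H2_iff zshift_zshift)
  consider "i = j" | "i > j" | "i < j" by linarith
  thus ?thesis
  proof cases
    case 1
    thus ?thesis using t_H2 t_norm by (simp add: h2_inner_self nsq_zshift zshift_H2_iff)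
  next
    case 2
    thus ?thesis using *[of "i - j" j] by simp
  next
    case 3
    hence "h2_inner (zshift j t) (zshift i t) = 0" using *[of "j - i" i] by simp
    thus ?thesis using 3 h2_inner_commute[of "zshift j t" "zshift i t"] t_H2 by (simp add: zshift_H2_iff)
  qed
qed

lemma comb_H2: "(\<lambda>k. \<Sum>j<N. c j * zshift j t k) \<in> H2"
  by (intro H2_sum) (auto simp: zshift_H2_iff t_H2)

lemma comb_inner:
  "h2_inner (\<lambda>k. \<Sum>j<N. c j * zshift j t k) (zshift i t) = (if i < N then c i else 0)"
  by (subst h2_inner_sum) (auto simp: zshift_H2_iff t_H2 orthonormal if_distrib cong: if_cong)

lemma nsq_comb: "nsq (\<lambda>k. \<Sum>j<N. c j * zshift j t k) = (\<Sum>j<N. (cmod (c j))\<^sup>2)"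
proof (induction N)
  case 0
  show ?case by (simp add: nsq_def)
next
  case (Suc N)
  have "nsq (\<lambda>k. (\<Sum>j<N. c j * zshift j t k) + c N * zshift N t k) = (\<Sum>j<N. (cmod (c j))\<^sup>2) + (cmod (c N))\<^sup>2"
    using t_norm t_H2 by (subst nsq_add_scale) (auto simp: comb_H2 zshift_H2_iff comb_inner Suc.IH nsq_zshift)
  thus ?case by simp
qed

text \<open>On finite combinations of the orthonormal shifts the norm is known exactly, and any
  partial sum of the product only involves such a combination. Membership in \<open>H2\<close> is
  thus obtained without a prior bound on \<open>t\<close>.\<close>

lemma cprod_H2:
  assumes "h \<in> H2"
  shows "cprod t h \<in> H2" "nsq (cprod t h) \<le> nsq h"
proof -
  have *: "(\<Sum>k<N. (cmod (cprod t h k))\<^sup>2) \<le> nsq h" for N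
  proof -
    have "(\<Sum>k<N. (cmod (cprod t h k))\<^sup>2) = (\<Sum>k<N. (cmod (cprod t (trunc N h) k))\<^sup>2)"
      by (intro sum.cong) (auto simp: cprod_local)
    also have "\<dots> \<le> nsq (cprod t (trunc N h))"
      unfolding cprod_trunc by (intro nsq_partial_le comb_H2) auto
    also have "\<dots> = (\<Sum>j<N. (cmod (h j))\<^sup>2)" unfolding cprod_trunc by (rule nsq_comb)
    also have "\<dots> \<le> nsq h" by (intro nsq_partial_le assms) auto
    finally show ?thesis .
  qed
  show "cprod t h \<in> H2" "nsq (cprod t h) \<le> nsq h" using H2_bounded_partial[OF *] by auto
qed

lemma cprod_trunc_tendsto:
  assumes "h \<in> H2"
  shows "(\<lambda>N. nsq (\<lambda>k. cprod t h k - cprod t (trunc N h) k)) \<longlonglongrightarrow> 0"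
proof (rule tendsto_sandwich[OF _ _ tendsto_const nsq_diff_trunc_tendsto[OF assms]])
  have d: "(\<lambda>k. h k - trunc N h k) \<in> H2" for N by (intro H2_diff assms H2_trunc)
  show "\<forall>\<^sub>F N in sequentially. 0 \<le> nsq (\<lambda>k. cprod t h k - cprod t (trunc N h) k)"
    by (intro always_eventually allI nsq_nonneg H2_diff cprod_H2 assms H2_trunc)
  show "\<forall>\<^sub>F N in sequentially. nsq (\<lambda>k. cprod t h k - cprod t (trunc N h) k) \<le> nsq (\<lambda>k. h k - trunc N h k)"
    using cprod_H2(2)[OF d] by (intro always_eventually allI) (simp add: cprod_diff_right)
qed

lemma cprod_inner:
  assumes "h \<in> H2"
  shows "h2_inner (cprod t h) (zshift j t) = h j"
proof -
  have "(\<lambda>N. h2_inner (cprod t (trunc N h)) (zshift j t)) \<longlonglongrightarrow> h2_inner (cprod t h) (zshift j t)"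
    by (rule h2_inner_tendsto_left[OF _ _ _ cprod_trunc_tendsto[OF assms]])
       (auto intro!: cprod_H2 assms H2_trunc simp: zshift_H2_iff t_H2)
  moreover have "(\<lambda>N. h2_inner (cprod t (trunc N h)) (zshift j t)) \<longlonglongrightarrow> h j"
    unfolding cprod_trunc comb_inner
    by (rule tendsto_eventually) (auto simp: eventually_sequentially intro!: exI[of _ "Suc j"])
  ultimately show ?thesis by (rule LIMSEQ_unique)
qed

text \<open>Pairing the product of \<open>t\<close> and the reproducing kernel at \<open>w\<close>
  with that kernel gives t(w) times the squared norm of the kernel. Since multiplication by
  \<open>t\<close> is a contraction, Cauchy-Schwarz bounds t(w).\<close>

lemma bounded_by_1:
  assumes w: "cmod w < 1"
  shows "cmod (seq_fun t w) \<le> 1"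
proof -
  define kw where "kw = (\<lambda>k. cnj w ^ k)"
  define s where "s = 1 / (1 - (cmod w)\<^sup>2)"
  have w2: "(cmod w)\<^sup>2 < 1" using w by (simp add: abs_square_less_1)
  have s0: "s > 0" using w2 by (simp add: s_def)
  have gs: "(\<lambda>k. ((cmod w)\<^sup>2) ^ k) sums s" unfolding s_def using w2 by (intro geometric_sums) simp
  have "(\<lambda>k. (cmod (kw k))\<^sup>2) = (\<lambda>k. ((cmod w)\<^sup>2) ^ k)"
    by (auto simp: kw_def norm_power power_mult[symmetric] mult.commute)
  hence kH: "kw \<in> H2" and kn: "nsq kw = s" using gs by (auto simp: H2_def nsq_def sums_iff)
  have ev: "seq_fun h w = h2_inner h kw" for h
    unfolding seq_fun_def h2_inner_def kw_def by simp
  have "seq_fun kw w = of_real s" using h2_inner_self[OF kH] kn ev by simp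
  moreover have "seq_fun (cprod t kw) w = seq_fun t w * seq_fun kw w"
  proof -
    have "(\<Sum>k. t k * w ^ k) * (\<Sum>k. kw k * w ^ k) = (\<Sum>k. \<Sum>i\<le>k. (t i * w ^ i) * (kw (k - i) * w ^ (k - i)))"
      using H2_power_series_abs_summable[OF t_H2 w] H2_power_series_abs_summable[OF kH w]
      by (intro Cauchy_product) (simp_all add: norm_mult norm_power)
    also have "\<dots> = (\<Sum>k. cprod t kw k * w ^ k)"
    proof (intro suminf_cong)
      fix k
      have "(t i * w ^ i) * (kw (k - i) * w ^ (k - i)) = t i * kw (k - i) * w ^ k" if "i \<le> k" for i
        using that power_add[of w i "k - i"] by simp
      thus "(\<Sum>i\<le>k. (t i * w ^ i) * (kw (k - i) * w ^ (k - i))) = cprod t kw k * w ^ k"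
        unfolding cprod_def sum_distrib_right by (intro sum.cong) auto
    qed
    finally show ?thesis by (simp add: seq_fun_def)
  qed
  ultimately have eq: "h2_inner (cprod t kw) kw = seq_fun t w * of_real s" using ev[of "cprod t kw"] by simp
  have "(cmod (seq_fun t w) * s)\<^sup>2 = (cmod (h2_inner (cprod t kw) kw))\<^sup>2"
    unfolding eq norm_mult norm_of_real using s0 by simp
  also have "\<dots> \<le> nsq (cprod t kw) * nsq kw" by (intro h2_Cauchy_Schwarz cprod_H2 kH)
  also have "\<dots> \<le> s * s" using cprod_H2(2)[OF kH] kn s0 by (intro mult_mono) auto
  finally have "(cmod (seq_fun t w) * s)\<^sup>2 \<le> (1 * s)\<^sup>2" by (simp add: power2_eq_square)
  hence "cmod (seq_fun t w) * s \<le> 1 * s" using s0 by (subst (asm) power2_le_iff_abs_le) auto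
  thus ?thesis using s0 by (subst (asm) mult_le_cancel_right_pos) auto
qed

lemma inner_fn: "inner_fn t"
  by (rule inner_fnI[OF t_H2 t_norm bounded_by_1])

text \<open>Monomials of high degree are nearly in the range of multiplication by \<open>t\<close>, so no nonzero
  function has all its shifts orthogonal to that range.\<close>

lemma eq_zero_if_shifts_orthogonal:
  assumes f: "f \<in> H2" and orth: "\<And>K j. h2_inner (zshift K f) (zshift j t) = 0"
  shows "f = (\<lambda>_. 0)"
proof
  fix b
  have le: "(cmod (f b))\<^sup>2 \<le> nsq f * (1 - (\<Sum>j<Suc (K + b). (cmod (t j))\<^sup>2))" for K
  proof -
    define m where "m = K + b"
    \<comment> \<open>These are the inner products of the monomial \<open>zmono m\<close> with the
      shifts of \<open>t\<close>, so \<open>u\<close> is its projection onto the span of the first m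
      + 1 shifts. Its squared distance from \<open>u\<close> is 1 - \<sigma>, and \<open>f b\<close>
      is the inner product of \<open>zshift K f\<close> with \<open>zmono m\<close>.\<close>
    define c where "c j = cnj (t (m - j))" for j
    define u where "u = (\<lambda>k. \<Sum>j<Suc m. c j * zshift j t k)"
    define \<sigma> where "\<sigma> = (\<Sum>j<Suc m. (cmod (t j))\<^sup>2)"
    have uH: "u \<in> H2" unfolding u_def by (rule comb_H2)
    have rev: "(\<Sum>j<Suc m. (cmod (c j))\<^sup>2) = \<sigma>"
      unfolding \<sigma>_def c_def lessThan_Suc_atMost
      by (intro sum.reindex_bij_witness[of _ "\<lambda>k. m - k" "\<lambda>k. m - k"]) auto
    have nu: "nsq u = \<sigma>" unfolding u_def nsq_comb rev ..
    have "u m = (\<Sum>j<Suc m. of_real ((cmod (c j))\<^sup>2))"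
      unfolding u_def complex_norm_square c_def by (intro sum.cong) (auto simp: zshift_def mult.commute)
    hence um: "u m = of_real \<sigma>" unfolding rev[symmetric] by simp
    have inm: "h2_inner a (zmono m) = a m" for a
    proof -
      have "(\<lambda>k. a k * cnj (zmono m k)) sums (\<Sum>k\<in>{m}. a k * cnj (zmono m k))"
        by (intro sums_finite) (auto simp: zmono_def)
      thus ?thesis by (simp add: h2_inner_def sums_iff zmono_def)
    qed
    have nm: "nsq (zmono m) = 1"
      using inm[of "zmono m"] h2_inner_self[OF zmono_H2, of m] by (simp add: zmono_def)
    have zu: "h2_inner (zmono m) u = of_real \<sigma>"
      using h2_inner_commute[OF uH zmono_H2, of m] inm[of u] um by simp
    have nd: "nsq (\<lambda>k. zmono m k + (-1) * u k) = 1 - \<sigma>"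
      unfolding nsq_add_scale[OF zmono_H2 uH] nm nu zu by simp
    have sf: "zshift K f \<in> H2" using f by (simp add: zshift_H2_iff)
    have "h2_inner u (zshift K f) = 0"
      unfolding u_def using t_H2 sf
      by (subst h2_inner_sum) (auto simp: zshift_H2_iff h2_inner_commute[of "zshift K f"] orth)
    hence "h2_inner (zshift K f) u = 0" using h2_inner_commute[OF uH sf] by simp
    hence "h2_inner (zshift K f) (\<lambda>k. zmono m k + (-1) * u k) = f b"
      unfolding h2_inner_add_scale_right[OF zmono_H2 uH sf] inm by (simp add: m_def zshift_def)
    hence "(cmod (f b))\<^sup>2 \<le> nsq (zshift K f) * nsq (\<lambda>k. zmono m k + (-1) * u k)"
      using h2_Cauchy_Schwarz[OF sf H2_add_scale[OF zmono_H2 uH, of m "-1"]] by simp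
    thus ?thesis unfolding nd nsq_zshift[OF f] unfolding \<sigma>_def m_def .
  qed
  \<comment> \<open>Because \<open>t\<close> has norm 1, the distance of the monomials from the
    range tends to 0 as \<open>K\<close> grows.\<close>
  have "(\<lambda>N. \<Sum>j<N. (cmod (t j))\<^sup>2) \<longlonglongrightarrow> 1"
    using summable_LIMSEQ[OF H2_summable[OF t_H2]] t_norm by (simp add: nsq_def)
  hence "(\<lambda>K. \<Sum>j<K + Suc b. (cmod (t j))\<^sup>2) \<longlonglongrightarrow> 1" by (rule LIMSEQ_ignore_initial_segment)
  hence "(\<lambda>K. nsq f * (1 - (\<Sum>j<K + Suc b. (cmod (t j))\<^sup>2))) \<longlonglongrightarrow> nsq f * (1 - 1)"
    by (intro tendsto_intros)
  hence "(cmod (f b))\<^sup>2 \<le> nsq f * (1 - 1)" using le by (intro LIMSEQ_le_const) auto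
  thus "f b = 0" by simp
qed

text \<open>Bessel's inequality for the orthonormal shifts of \<open>t\<close>.\<close>

lemma coefficients_H2:
  assumes "a \<in> H2"
  shows "(\<lambda>j. h2_inner a (zshift j t)) \<in> H2"
proof (rule H2_bounded_partial(1)[where B = "nsq a"])
  fix N
  define h where "h j = h2_inner a (zshift j t)" for j
  define u where "u = (\<lambda>k. \<Sum>j<N. h j * zshift j t k)"
  have uH: "u \<in> H2" unfolding u_def by (rule comb_H2)
  have "h2_inner u a = (\<Sum>j<N. h j * cnj (h j))"
    unfolding u_def h_def using t_H2 assms
    by (subst h2_inner_sum) (auto simp: zshift_H2_iff h2_inner_commute[of a])
  hence "h2_inner u a = of_real (\<Sum>j<N. (cmod (h j))\<^sup>2)"
    unfolding complex_norm_square[symmetric] of_real_sum .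
  hence "h2_inner a u = of_real (\<Sum>j<N. (cmod (h j))\<^sup>2)"
    using h2_inner_commute[OF uH assms] by simp
  hence "nsq (\<lambda>k. a k + (-1) * u k) = nsq a - (\<Sum>j<N. (cmod (h j))\<^sup>2)"
    unfolding nsq_add_scale[OF assms uH] using nsq_comb[of h N, folded u_def] by simp
  thus "(\<Sum>j<N. (cmod (h2_inner a (zshift j t)))\<^sup>2) \<le> nsq a"
    using nsq_nonneg[OF H2_add_scale[OF assms uH, of "-1"]] by (simp add: h_def)
qed

end

text \<open>Let \<open>m\<close> be the lowest order of vanishing in \<open>N\<close>. Shifts of
  elements of \<open>N\<close> have order above \<open>m\<close>, so the unit vector
  \<open>v\<close> of order \<open>m\<close> orthogonal to that higher layer is wandering. Dividing
  it by z^n gives \<open>t\<close>.\<close>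

theorem beurling:
  assumes N: "closed_subspace N" "N \<subseteq> zH2 n" "N \<noteq> {\<lambda>_. 0}"
    and inv: "\<And>a. a \<in> N \<Longrightarrow> Mz a \<in> N"
  obtains t where "wandering_unit t" "N = zthetaH2 n t"
proof -
  have shift: "zshift k a \<in> N" if "a \<in> N" for a k
  proof (induction k)
    case (Suc k)
    show ?case using inv[OF Suc] by (simp add: Mz_eq_zshift zshift_zshift)
  qed (use that in simp)
  obtain a0 where "a0 \<in> N" "a0 \<noteq> (\<lambda>_. 0)" using N(3) closed_subspace_zero[OF N(1)] by blast
  hence ex: "\<exists>m. \<exists>a\<in>N. a m \<noteq> 0" by (auto simp: fun_eq_iff)
  define m where "m = (LEAST m. \<exists>a\<in>N. a m \<noteq> 0)"
  obtain b where b: "b \<in> N" "b m \<noteq> 0" using LeastI_ex[OF ex] unfolding m_def by blast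
  have NH: "a \<in> H2" if "a \<in> N" for a using that closed_subspace_H2[OF N(1)] by blast
  have Nm: "a \<in> zH2 m" if "a \<in> N" for a
    using that NH not_less_Least[of _ "\<lambda>m. \<exists>a\<in>N. a m \<noteq> 0"] unfolding m_def zH2_def by blast
  obtain \<phi> where \<phi>: "\<phi> \<in> N" "\<And>g. g \<in> N \<Longrightarrow> g \<in> zH2 (Suc m) \<Longrightarrow> h2_inner \<phi> g = 0"
    "\<And>b. b \<in> N \<Longrightarrow> b \<in> zH2 m \<Longrightarrow> (\<lambda>k. b k - b m * \<phi> k) \<in> zH2 (Suc m)"
    by (rule closed_subspace_layer[OF N(1), of m]) blast
  have \<phi>H: "\<phi> \<in> H2" by (rule NH[OF \<phi>(1)])
  have "\<forall>k<Suc m. b k - b m * \<phi> k = 0"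
    using \<phi>(3)[OF b(1) Nm[OF b(1)]] unfolding zH2_def by blast
  from this[rule_format, OF lessI] have "b m - b m * \<phi> m = 0" .
  hence "\<phi> m = 1" using b(2) by simp
  hence n1: "nsq \<phi> > 0" using nsq_coord_le[OF \<phi>H, of m] by simp
  define v where "v = (\<lambda>k. of_real (1 / sqrt (nsq \<phi>)) * \<phi> k)"
  have vN: "v \<in> N" unfolding v_def by (rule closed_subspace_scale[OF N(1) \<phi>(1)])
  have vH: "v \<in> H2" by (rule NH[OF vN])
  have "nsq (\<lambda>k. 0 + of_real (1 / sqrt (nsq \<phi>)) * \<phi> k) = (cmod (of_real (1 / sqrt (nsq \<phi>))))\<^sup>2 * nsq \<phi>"
    by (subst nsq_add_scale[OF H2_zero \<phi>H]) (simp add: nsq_def)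
  also have "\<dots> = 1" using n1 by (simp add: norm_divide power_divide)
  finally have vn: "nsq v = 1" by (simp add: v_def)
  have vorth: "h2_inner v g = 0" if "g \<in> N" "g \<in> zH2 (Suc m)" for g
    unfolding v_def using \<phi>(2)[OF that] \<phi>H NH[OF that(1)] by (subst h2_inner_scale) auto
  define t where "t = (\<lambda>k. v (k + n))"
  have unshift: "zshift n (\<lambda>k. a (k + n)) = a" if "a \<in> N" for a
    using that N(2) by (auto simp: zH2_def zshift_def fun_eq_iff not_less)
  have vt: "zshift n t = v" unfolding t_def by (rule unshift[OF vN])
  have tH: "t \<in> H2" using vH unfolding vt[symmetric] zshift_H2_iff .
  have shm: "zshift k a \<in> zH2 (Suc m)" if "a \<in> N" "k \<ge> 1" for a k
    using zshift_zH2[OF Nm[OF that(1)], of k] that(2) by (auto simp: zH2_def)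
  interpret wandering_unit t
  proof
    show "t \<in> H2" by (rule tH)
    show "nsq t = 1" using nsq_zshift[OF tH, of n] vn vt by simp
    fix k :: nat assume k: "k \<ge> 1"
    have "h2_inner v (zshift k v) = 0" by (intro vorth shift vN shm k)
    hence "h2_inner (zshift k v) v = 0"
      using h2_inner_commute[OF vH, of "zshift k v"] vH by (simp add: zshift_H2_iff)
    hence "h2_inner (zshift n (zshift k t)) (zshift n t) = 0"
      unfolding zshift_zshift vt[symmetric] by (simp add: add.commute)
    thus "h2_inner (zshift k t) t = 0" using tH by (subst (asm) h2_inner_zshift) (auto simp: zshift_H2_iff)
  qed
  \<comment> \<open>For polynomials \<open>h\<close> this is a finite combination of shifts of
    \<open>v\<close>; closedness of \<open>N\<close> gives the rest.\<close>
  have in_N: "zshift n (cprod t h) \<in> N" if h: "h \<in> H2" for h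
  proof (rule closed_subspace_limit[OF N(1)])
    show "zshift n (cprod t (trunc M h)) \<in> N" for M
    proof -
      have "zshift n (cprod t (trunc M h)) = (\<lambda>k. \<Sum>j<M. h j * zshift n (zshift j t) k)"
        unfolding cprod_trunc zshift_def by (auto simp: fun_eq_iff)
      also have "\<dots> = (\<lambda>k. \<Sum>j<M. h j * zshift j v k)"
        unfolding zshift_zshift vt[symmetric] by (simp add: add.commute)
      finally have "zshift n (cprod t (trunc M h)) = (\<lambda>k. \<Sum>j<M. h j * zshift j v k)" .
      thus ?thesis using closed_subspace_sum[OF N(1), of "{..<M}" "\<lambda>j. zshift j v" h] shift[OF vN] by simp
    qed
    show "zshift n (cprod t h) \<in> H2" using cprod_H2[OF h] by (simp add: zshift_H2_iff)
    have "nsq (\<lambda>k. zshift n (cprod t h) k - zshift n (cprod t (trunc M h)) k) = 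
        nsq (\<lambda>k. cprod t h k - cprod t (trunc M h) k)" for M
      unfolding zshift_diff[symmetric] by (intro nsq_zshift H2_diff cprod_H2 h H2_trunc)
    thus "(\<lambda>M. nsq (\<lambda>k. zshift n (cprod t h) k - zshift n (cprod t (trunc M h)) k)) \<longlonglongrightarrow> 0"
      using cprod_trunc_tendsto[OF h] by simp
  qed
  have "N \<subseteq> zthetaH2 n t"
  proof
    fix a assume a: "a \<in> N"
    define a' where "a' = (\<lambda>k. a (k + n))"
    have aa: "zshift n a' = a" unfolding a'_def by (rule unshift[OF a])
    have a'H: "a' \<in> H2" using NH[OF a] unfolding aa[symmetric] zshift_H2_iff .
    define h where "h = (\<lambda>j. h2_inner a' (zshift j t))"
    have hH: "h \<in> H2" unfolding h_def by (rule coefficients_H2[OF a'H])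
    \<comment> \<open>The component of \<open>a'\<close> orthogonal to the range of multiplication
      by \<open>t\<close>; it has to vanish.\<close>
    define f where "f = (\<lambda>k. a' k - cprod t h k)"
    have fH: "f \<in> H2" unfolding f_def by (intro H2_diff a'H cprod_H2 hH)
    have f1: "h2_inner f (zshift j t) = 0" for j
      unfolding f_def using cprod_inner[OF hH, of j] a'H cprod_H2[OF hH] tH
      by (subst h2_inner_diff) (auto simp: zshift_H2_iff h_def)
    have fN: "zshift n f \<in> N"
      unfolding f_def zshift_diff aa by (intro closed_subspace_diff N a in_N hH)
    \<comment> \<open>Here the wandering property of \<open>v\<close> is applied to the residual
      itself, which after multiplication by z^n again lies in \<open>N\<close>.\<close>
    have f2: "h2_inner (zshift k f) t = 0" if "k \<ge> 1" for k
    proof -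
      have "h2_inner v (zshift k (zshift n f)) = 0" by (intro vorth shift fN shm that)
      hence "h2_inner (zshift n t) (zshift n (zshift k f)) = 0"
        unfolding zshift_zshift vt by (simp add: add.commute)
      hence "h2_inner t (zshift k f) = 0" using tH fH by (subst (asm) h2_inner_zshift) (auto simp: zshift_H2_iff)
      thus ?thesis using h2_inner_commute[OF tH, of "zshift k f"] fH by (simp add: zshift_H2_iff)
    qed
    \<comment> \<open>Cancelling the common shift leaves either \<open>f\<close> against a shift of
      \<open>t\<close>, which is \<open>f1\<close>, or a proper shift of \<open>f\<close> against
      \<open>t\<close>, which is \<open>f2\<close>.\<close>
    have "h2_inner (zshift k f) (zshift j t) = 0" for k j
    proof (cases "k \<le> j")
      case True
      have "h2_inner (zshift k f) (zshift k (zshift (j - k) t)) = h2_inner f (zshift (j - k) t)"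
        using fH tH by (intro h2_inner_zshift) (auto simp: zshift_H2_iff)
      thus ?thesis using True f1 by (simp add: zshift_zshift)
    next
      case False
      have "h2_inner (zshift j (zshift (k - j) f)) (zshift j t) = h2_inner (zshift (k - j) f) t"
        using fH tH by (intro h2_inner_zshift) (auto simp: zshift_H2_iff)
      thus ?thesis using False f2[of "k - j"] by (simp add: zshift_zshift)
    qed
    hence "f = (\<lambda>_. 0)" by (rule eq_zero_if_shifts_orthogonal[OF fH])
    hence "a' = cprod t h" by (auto simp: f_def fun_eq_iff)
    hence "a = zshift n (cprod t h)" using aa by simp
    thus "a \<in> zthetaH2 n t" using hH unfolding zthetaH2_def by blast
  qed
  moreover have "zthetaH2 n t \<subseteq> N" using in_N unfolding zthetaH2_def by blast
  ultimately show ?thesis using that wandering_unit_axioms by blast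
qed

section \<open>Perturbed shifts\<close>

lemma bounded_op_linear:
  "bounded_op T \<Longrightarrow> a \<in> H2 \<Longrightarrow> b \<in> H2 \<Longrightarrow> T (\<lambda>k. a k + c * b k) = (\<lambda>k. T a k + c * T b k)"
  unfolding bounded_op_def by blast

lemma bounded_op_H2: "bounded_op T \<Longrightarrow> a \<in> H2 \<Longrightarrow> T a \<in> H2"
  unfolding bounded_op_def by blast

lemma bounded_op_zero:
  assumes "bounded_op T"
  shows "T (\<lambda>_. 0) = (\<lambda>_. 0)"
proof
  fix k
  have "T (\<lambda>k. 0 + 1 * 0) = (\<lambda>k. T (\<lambda>_. 0) k + 1 * T (\<lambda>_. 0) k)"
    by (rule bounded_op_linear[OF assms H2_zero H2_zero])
  from fun_cong[OF this, of k] show "T (\<lambda>_. 0) k = 0" by simp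
qed

lemma bounded_op_sum:
  assumes T: "bounded_op T" and "finite A" "\<And>i. i \<in> A \<Longrightarrow> f i \<in> H2"
  shows "T (\<lambda>k. \<Sum>i\<in>A. c i * f i k) = (\<lambda>k. \<Sum>i\<in>A. c i * T (f i) k)"
  using assms(2,3)
proof (induction A rule: finite_induct)
  case empty
  show ?case using bounded_op_zero[OF T] by simp
next
  case (insert i A)
  have "T (\<lambda>k. (\<Sum>i\<in>A. c i * f i k) + c i * f i k) = (\<lambda>k. T (\<lambda>k. \<Sum>i\<in>A. c i * f i k) k + c i * T (f i) k)"
    by (rule bounded_op_linear[OF T]) (use insert in \<open>auto intro!: H2_sum\<close>)
  thus ?case using insert by (simp add: add.commute)
qed

text \<open>Linearity covers the truncations of \<open>a\<close>, and boundedness carries the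
  conclusion to their limit. For \<open>F\<close> this means that the perturbed shift is the plain
  shift on z^n H^2.\<close>

lemma bounded_op_vanishes:
  assumes T: "bounded_op T" and z: "\<And>m. m \<ge> n \<Longrightarrow> T (zmono m) = (\<lambda>_. 0)" and a: "a \<in> zH2 n"
  shows "T a = (\<lambda>_. 0)"
proof -
  have aH: "a \<in> H2" and a0: "\<And>k. k < n \<Longrightarrow> a k = 0" using a by (auto simp: zH2_def)
  have tr: "T (trunc N a) = (\<lambda>_. 0)" for N
  proof -
    have "trunc N a = (\<lambda>k. \<Sum>j<N. a j * zmono j k)"
      by (auto simp: trunc_def zmono_def fun_eq_iff if_distrib cong: if_cong)
    hence "T (trunc N a) = (\<lambda>k. \<Sum>j<N. a j * T (zmono j) k)"
      using bounded_op_sum[OF T, of "{..<N}" zmono a] zmono_H2 by simp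
    also have "\<dots> = (\<lambda>_. 0)"
    proof (intro ext sum.neutral ballI)
      fix k j
      show "a j * T (zmono j) k = 0" using a0[of j] z[of j] by (cases "j < n") auto
    qed
    finally show ?thesis .
  qed
  obtain C where C: "\<And>b. b \<in> H2 \<Longrightarrow> h2_norm (T b) \<le> C * h2_norm b"
    using T unfolding bounded_op_def by blast
  have le: "h2_norm (T a) \<le> C * sqrt (nsq (\<lambda>k. a k - trunc N a k))" for N
  proof -
    have "T (\<lambda>k. a k + (-1) * trunc N a k) = (\<lambda>k. T a k + (-1) * T (trunc N a) k)"
      by (rule bounded_op_linear[OF T aH H2_trunc])
    hence "T (\<lambda>k. a k - trunc N a k) = T a" by (simp add: tr)
    thus ?thesis using C[OF H2_diff[OF aH H2_trunc[of N a]]] by (simp add: h2_norm_nsq)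
  qed
  have "(\<lambda>N. C * sqrt (nsq (\<lambda>k. a k - trunc N a k))) \<longlonglongrightarrow> C * sqrt 0"
    by (intro tendsto_intros nsq_diff_trunc_tendsto aH)
  hence "h2_norm (T a) \<le> C * sqrt 0" using le by (intro LIMSEQ_le_const) auto
  hence "nsq (T a) \<le> 0" by (simp add: h2_norm_nsq)
  thus ?thesis by (rule nsq_zero_imp[OF bounded_op_H2[OF T aH]])
qed

lemma closed_subspace_Int_zH2:
  assumes "closed_subspace M"
  shows "closed_subspace (M \<inter> zH2 m)"
  unfolding closed_subspace_def
proof (intro conjI allI impI ballI)
  show "M \<inter> zH2 m \<subseteq> H2" by (auto simp: zH2_def)
  show "(\<lambda>_. 0) \<in> M \<inter> zH2 m" using closed_subspace_zero[OF assms] by (simp add: zH2_def H2_zero)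
  show "(\<lambda>k. a k + c * b k) \<in> M \<inter> zH2 m" if "a \<in> M \<inter> zH2 m" "b \<in> M \<inter> zH2 m" for a b c
    using that closed_subspace_add_scale[OF assms, of a b c] by (auto simp: zH2_def H2_add_scale)
next
  fix x a assume x: "\<forall>j. x j \<in> M \<inter> zH2 m" and a: "a \<in> H2"
    and lim: "(\<lambda>j. h2_norm (\<lambda>k. x j k - a k)) \<longlonglongrightarrow> 0"
  have "a \<in> M" using assms x a lim unfolding closed_subspace_def by blast
  moreover have "a k = 0" if "k < m" for k
  proof -
    have "cmod (a k) \<le> h2_norm (\<lambda>k. x j k - a k)" for j
    proof -
      have xj: "x j \<in> H2" "x j k = 0" using x that by (auto simp: zH2_def)
      have "(cmod (a k))\<^sup>2 \<le> nsq (\<lambda>k. x j k - a k)"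
        using nsq_coord_le[OF H2_diff[OF xj(1) a], of k] xj(2) by simp
      thus ?thesis unfolding h2_norm_nsq by (rule real_le_rsqrt)
    qed
    hence "cmod (a k) \<le> 0" using LIMSEQ_le_const[OF lim] by blast
    thus ?thesis by simp
  qed
  ultimately show "a \<in> M \<inter> zH2 m" using a by (simp add: zH2_def)
qed

lemma span_plus_subset:
  assumes "closed_subspace M" "finite I" "\<And>i. i \<in> I \<Longrightarrow> ph i \<in> M" "G \<subseteq> M"
  shows "span_plus ph I G \<subseteq> M"
proof
  fix a assume "a \<in> span_plus ph I G"
  then obtain c g where a: "a = (\<lambda>k. (\<Sum>i\<in>I. c i * ph i k) + 1 * g k)" "g \<in> G"
    by (auto simp: span_plus_def)
  show "a \<in> M" unfolding a(1)
    by (intro closed_subspace_add_scale closed_subspace_sum assms) (use a assms in auto)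
qed

section \<open>Layers of invariant subspaces of the perturbed shift\<close>

locale perturbed_shift =
  fixes n :: nat and F :: "seq \<Rightarrow> seq"
  assumes pert: "n_perturbation n F"
begin

abbreviation "S \<equiv> Sop F"

lemma S_op: "bounded_op S"
  using pert unfolding n_perturbation_def left_invertible_def by blast

lemma F_zero: "a \<in> zH2 n \<Longrightarrow> F a = (\<lambda>_. 0)"
  by (rule bounded_op_vanishes) (use pert in \<open>auto simp: n_perturbation_def\<close>)

lemma F_zpoly: "a \<in> zH2 m \<Longrightarrow> F a \<in> zpoly (Suc m)"
  using pert unfolding n_perturbation_def by blast

lemma S_high: "a \<in> zH2 n \<Longrightarrow> S a = Mz a"
  by (simp add: Sop_def F_zero)

lemma S_H2: "a \<in> H2 \<Longrightarrow> S a \<in> H2"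
  by (rule bounded_op_H2[OF S_op])

lemma S_layer:
  assumes "a \<in> zH2 m"
  shows "S a \<in> zH2 (Suc m)"
proof -
  obtain p where "F a = coeff p" "\<forall>k<Suc m. coeff p k = 0" using F_zpoly[OF assms] by (auto simp: zpoly_def)
  moreover have "a \<in> H2" using assms by (simp add: zH2_def)
  ultimately show ?thesis using assms S_H2[of a] by (auto simp: zH2_def Sop_def Mz_def)
qed

lemma S_inj:
  assumes "a \<in> H2" "S a = (\<lambda>_. 0)"
  shows "a = (\<lambda>_. 0)"
proof -
  obtain L where "bounded_op L" "\<forall>a\<in>H2. L (S a) = a"
    using pert unfolding n_perturbation_def left_invertible_def by blast
  thus ?thesis using assms bounded_op_zero[of L] by metis
qed

lemma S_pow_H2: "a \<in> H2 \<Longrightarrow> (S ^^ k) a \<in> H2"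
  by (induction k) (auto intro: S_H2)

lemma S_pow_layer: "a \<in> zH2 m \<Longrightarrow> (S ^^ k) a \<in> zH2 (m + k)"
  by (induction k) (auto intro: S_layer)

lemma S_pow_inj: "a \<in> H2 \<Longrightarrow> (S ^^ k) a = (\<lambda>_. 0) \<Longrightarrow> a = (\<lambda>_. 0)"
  by (induction k) (auto dest: S_inj[OF S_pow_H2])

text \<open>\<open>F\<close> has polynomial values on all of \<open>H2\<close>, so each further
  application of \<open>S\<close> shifts the polynomial error and adds another polynomial.\<close>

lemma S_pow_eq:
  assumes a: "a \<in> H2"
  shows "\<exists>q. (S ^^ k) a = (\<lambda>i. zshift k a i + coeff q i)"
proof (induction k)
  case 0
  show ?case by (intro exI[of _ 0]) simp
next
  case (Suc k)
  then obtain q where q: "(S ^^ k) a = (\<lambda>i. zshift k a i + coeff q i)" by blast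
  have "(S ^^ k) a \<in> zH2 0" using S_pow_H2[OF a] by (simp add: zH2_def)
  then obtain q' where q': "F ((S ^^ k) a) = coeff q'" using F_zpoly[of "(S ^^ k) a" 0] by (auto simp: zpoly_def)
  have "(S ^^ Suc k) a i = zshift (Suc k) a i + coeff (pCons 0 q + q') i" for i
    using fun_cong[OF q', of i] fun_cong[OF q, of "i - 1"]
    by (cases i) (auto simp: Sop_def Mz_def zshift_def)
  thus ?case by blast
qed

text \<open>One function \<open>h\<close> describes both the image of \<open>\<phi>\<close> in z^n t
  H^2 and, after division by z^(n-i), \<open>\<phi>\<close> up to a polynomial. The polynomial
  \<open>p\<close> in the two conclusions is therefore the same.\<close>

lemma layer_generator_form:
  assumes t: "wandering_unit t" and i: "i < n" and \<phi>: "\<phi> \<in> zH2 i"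
    and orth: "\<And>g. g \<in> zthetaH2 n t \<Longrightarrow> h2_inner \<phi> g = 0"
    and into: "(S ^^ (n - i)) \<phi> \<in> zthetaH2 n t"
  obtains p q where "\<phi> = phi t p q i" "(S ^^ (n - i)) \<phi> = zshift n (cprod (coeff p) t)"
proof -
  interpret wandering_unit t by (rule t)
  have \<phi>H: "\<phi> \<in> H2" using \<phi> by (simp add: zH2_def)
  obtain h where h: "h \<in> H2" "(S ^^ (n - i)) \<phi> = zshift n (cprod t h)"
    using into by (auto simp: zthetaH2_def)
  obtain q0 where q0: "(S ^^ (n - i)) \<phi> = (\<lambda>k. zshift (n - i) \<phi> k + coeff q0 k)"
    using S_pow_eq[OF \<phi>H] by blast
  \<comment> \<open>Division by z^(n-i): the coefficients of \<open>q0\<close> below that degree are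
    dropped, since only coefficients from n - i on determine \<open>\<phi>\<close>.\<close>
  define q where "q = poly_shift (n - i) q0"
  have eq: "\<phi> = (\<lambda>k. zshift i (cprod t h) k - coeff q k)"
  proof
    fix k
    have "zshift n (cprod t h) = zshift (n - i) (zshift i (cprod t h))"
      using i by (simp add: zshift_zshift)
    hence "zshift (n - i) (zshift i (cprod t h)) (k + (n - i)) = zshift (n - i) \<phi> (k + (n - i)) + coeff q0 (k + (n - i))"
      using h(2) q0 by metis
    thus "\<phi> k = zshift i (cprod t h) k - coeff q k" by (simp add: q_def coeff_poly_shift)
  qed
  have h0: "h k = 0" if "k > n + degree q" for k
  proof -
    \<comment> \<open>With this \<open>j\<close>, z^(n+j) t equals z^(i+k) t, whose inner product
      with z^i t h is \<open>h k\<close>. As \<open>k\<close> exceeds n + degree q, the subtraction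
      is not cut off at 0, and z^(n+j) t starts beyond the degree of \<open>q\<close>.\<close>
    define j where "j = k + i - n"
    have j: "n + j = i + k" using that by (simp add: j_def)
    have mem: "zshift (n + j) t \<in> zthetaH2 n t"
    proof -
      have "zshift j t = cprod t (zmono j)"
        unfolding cprod_commute[of t "zmono j"]
        by (auto simp: cprod_def zmono_def zshift_def fun_eq_iff if_distrib[of "\<lambda>x. x * _"] cong: if_cong)
      thus ?thesis using zmono_H2[of j] unfolding zthetaH2_def zshift_zshift[symmetric] by auto
    qed
    have zH: "zshift m t \<in> H2" for m using t_H2 by (simp add: zshift_H2_iff)
    have cH: "zshift m (cprod t h) \<in> H2" for m using cprod_H2[OF h(1)] by (simp add: zshift_H2_iff)
    have q_zero: "(\<lambda>l. coeff q l * cnj (zshift (n + j) t l)) = (\<lambda>_. 0)"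
    proof
      fix l
      show "coeff q l * cnj (zshift (n + j) t l) = 0"
        using that j by (cases "l \<le> degree q") (auto simp: zshift_less coeff_eq_0)
    qed
    have "0 = h2_inner (\<lambda>k. zshift i (cprod t h) k - coeff q k) (zshift (n + j) t)"
      using orth[OF mem] eq by simp
    also have "\<dots> = h2_inner (zshift i (cprod t h)) (zshift (n + j) t) - h2_inner (coeff q) (zshift (n + j) t)"
      by (intro h2_inner_diff cH H2_coeff zH)
    also have "h2_inner (coeff q) (zshift (n + j) t) = 0"
      unfolding h2_inner_def q_zero by simp
    also have "h2_inner (zshift i (cprod t h)) (zshift (n + j) t) = h2_inner (cprod t h) (zshift k t)"
      unfolding j zshift_zshift[symmetric] by (intro h2_inner_zshift cprod_H2 h zH)
    also have "\<dots> = h k" by (rule cprod_inner[OF h(1)])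
    finally show "h k = 0" by simp
  qed
  define p where "p = Abs_poly h"
  have p: "coeff p = h" unfolding p_def using h0 by (intro coeff_Abs_poly)
  show ?thesis
    by (rule that[of p q]) (use eq h(2) p cprod_commute[of t h] in \<open>auto simp: phi_def\<close>)
qed

lemma invariant_imp_form:
  assumes n: "n \<ge> 1" and M: "closed_subspace M" "M \<noteq> {\<lambda>_. 0}" and inv: "\<And>a. a \<in> M \<Longrightarrow> S a \<in> M"
  shows "\<exists>t p q. inner_fn t \<and>
       (\<forall>i<n. \<forall>j<n. i \<noteq> j \<longrightarrow> h2_inner (phi t (p i) (q i) i) (phi t (p j) (q j) j) = 0) \<and>
       (\<forall>i<n. \<forall>g\<in>zthetaH2 n t. h2_inner (phi t (p i) (q i) i) g = 0) \<and>
       M = span_plus (\<lambda>i. phi t (p i) (q i) i) {..<n} (zthetaH2 n t) \<and>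
       (\<forall>j. Suc j < n \<longrightarrow>
          S (phi t (p j) (q j) j) \<in> span_plus (\<lambda>i. phi t (p i) (q i) i) {Suc j..<n} (zthetaH2 n t)) \<and>
       S (phi t (p (n - 1)) (q (n - 1)) (n - 1)) = zshift n (cprod (coeff (p (n - 1))) t)"
proof -
  have MH: "a \<in> H2" if "a \<in> M" for a using closed_subspace_H2[OF M(1) that] .
  have pow: "(S ^^ k) a \<in> M" if "a \<in> M" for a k
    by (induction k) (use that inv in auto)
  define N where "N = M \<inter> zH2 n"
  have N: "closed_subspace N" unfolding N_def by (rule closed_subspace_Int_zH2[OF M(1)])
  obtain a where a: "a \<in> M" "a \<noteq> (\<lambda>_. 0)" using M closed_subspace_zero[OF M(1)] by blast
  have "a \<in> zH2 0" using MH[OF a(1)] by (simp add: zH2_def)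
  hence "(S ^^ n) a \<in> N" using S_pow_layer[of a 0 n] pow[OF a(1), of n] by (simp add: N_def)
  moreover have "(S ^^ n) a \<noteq> (\<lambda>_. 0)" using S_pow_inj[OF MH[OF a(1)]] a(2) by blast
  ultimately have N0: "N \<noteq> {\<lambda>_. 0}" by blast
  have Ninv: "Mz b \<in> N" if "b \<in> N" for b
    using that inv[of b] S_layer[of b n] S_high[of b] by (auto simp: N_def zH2_def)
  obtain t where t: "wandering_unit t" "N = zthetaH2 n t"
    using beurling[OF N _ N0 Ninv, of n] by (auto simp: N_def)
  \<comment> \<open>One generator for each order of vanishing; it is orthogonal to every element of
    \<open>M\<close> of higher order, hence to the later generators and to \<open>N\<close>.\<close>
  have "\<exists>\<phi>. \<phi> \<in> M \<and> \<phi> \<in> zH2 i \<and> (\<forall>g. g \<in> M \<longrightarrow> g \<in> zH2 (Suc i) \<longrightarrow> h2_inner \<phi> g = 0) \<and>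
     (\<forall>b. b \<in> M \<longrightarrow> b \<in> zH2 i \<longrightarrow> (\<lambda>k. b k - b i * \<phi> k) \<in> zH2 (Suc i))" for i
    by (rule closed_subspace_layer[OF M(1), of i]) blast
  then obtain \<phi> where \<phi>: "\<And>i. \<phi> i \<in> M" "\<And>i. \<phi> i \<in> zH2 i"
    and orth: "\<And>i g. g \<in> M \<Longrightarrow> g \<in> zH2 (Suc i) \<Longrightarrow> h2_inner (\<phi> i) g = 0"
    and dec: "\<And>i b. b \<in> M \<Longrightarrow> b \<in> zH2 i \<Longrightarrow> (\<lambda>k. b k - b i * \<phi> i k) \<in> zH2 (Suc i)"
    by metis
  have mono: "a \<in> zH2 i" if "a \<in> zH2 j" "i \<le> j" for a i j using that by (auto simp: zH2_def)
  have orthN: "h2_inner (\<phi> i) g = 0" if "i < n" "g \<in> zthetaH2 n t" for i g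
    using that mono[of g n "Suc i"] unfolding t(2)[symmetric] N_def by (intro orth) auto
  have "\<exists>p q. \<phi> i = phi t p q i \<and> (S ^^ (n - i)) (\<phi> i) = zshift n (cprod (coeff p) t)" if i: "i < n" for i
  proof -
    have "(S ^^ (n - i)) (\<phi> i) \<in> zthetaH2 n t"
      using S_pow_layer[OF \<phi>(2)[of i], of "n - i"] pow[OF \<phi>(1)[of i]] i unfolding t(2)[symmetric] N_def by simp
    thus ?thesis using layer_generator_form[OF t(1) i \<phi>(2) orthN[OF i]] by metis
  qed
  then obtain p q where pq: "\<And>i. i < n \<Longrightarrow> phi t (p i) (q i) i = \<phi> i"
    and pS: "\<And>i. i < n \<Longrightarrow> (S ^^ (n - i)) (\<phi> i) = zshift n (cprod (coeff (p i)) t)" by metis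
  let ?ph = "\<lambda>i. phi t (p i) (q i) i"
  \<comment> \<open>Stated for every starting order \<open>j\<close>: the case 0 gives the
    decomposition of \<open>M\<close>, the case \<open>Suc j\<close> the condition on the image of
    the \<open>j\<close>-th generator.\<close>
  have span: "b \<in> span_plus ?ph {j..<n} N" if "j \<le> n" "b \<in> M" "b \<in> zH2 j" for b j
    using that
  proof (induction j arbitrary: b rule: inc_induct)
    case base
    thus ?case by (auto simp: span_plus_def N_def)
  next
    case (step j)
    let ?b = "\<lambda>k. b k - b j * \<phi> j k"
    have "?b \<in> M" using closed_subspace_add_scale[OF M(1) step.prems(1) \<phi>(1)[of j], of "- b j"] by simp
    hence "?b \<in> span_plus ?ph {Suc j..<n} N" using dec[OF step.prems] by (intro step.IH)
    then obtain c g where cg: "?b = (\<lambda>k. (\<Sum>i\<in>{Suc j..<n}. c i * ?ph i k) + g k)" "g \<in> N"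
      by (auto simp: span_plus_def)
    \<comment> \<open>The coefficient of the \<open>j\<close>-th generator is the lowest Taylor
      coefficient of \<open>b\<close>, as provided by \<open>closed_subspace_layer\<close>.\<close>
    define c' where "c' = c(j := b j)"
    have "b = (\<lambda>k. (\<Sum>i\<in>{j..<n}. c' i * ?ph i k) + g k)"
    proof
      fix k
      have "(\<Sum>i\<in>{j..<n}. c' i * ?ph i k) = c' j * ?ph j k + (\<Sum>i\<in>{Suc j..<n}. c' i * ?ph i k)"
        using step.hyps by (intro sum.atLeast_Suc_lessThan) auto
      also have "(\<Sum>i\<in>{Suc j..<n}. c' i * ?ph i k) = (\<Sum>i\<in>{Suc j..<n}. c i * ?ph i k)"
        by (intro sum.cong) (auto simp: c'_def)
      finally show "b k = (\<Sum>i\<in>{j..<n}. c' i * ?ph i k) + g k"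
        using fun_cong[OF cg(1), of k] step.hyps by (simp add: c'_def pq algebra_simps)
    qed
    thus ?case using cg(2) unfolding span_plus_def by blast
  qed
  have "M = span_plus ?ph {..<n} (zthetaH2 n t)"
  proof
    show "M \<subseteq> span_plus ?ph {..<n} (zthetaH2 n t)"
      using span[of 0] MH unfolding t(2)[symmetric] by (auto simp: zH2_def atLeast0LessThan)
    show "span_plus ?ph {..<n} (zthetaH2 n t) \<subseteq> M"
      unfolding t(2)[symmetric] by (intro span_plus_subset M) (auto simp: pq \<phi> N_def)
  qed
  moreover have "h2_inner (?ph i) (?ph j) = 0" if "i < n" "j < n" "i \<noteq> j" for i j
  proof (cases "i < j")
    case True
    thus ?thesis using that mono[OF \<phi>(2)[of j], of "Suc i"] by (simp add: pq orth \<phi>)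
  next
    case False
    hence "h2_inner (\<phi> j) (\<phi> i) = 0" using that mono[OF \<phi>(2)[of i], of "Suc j"] by (simp add: orth \<phi>)
    thus ?thesis using that h2_inner_commute[OF MH[OF \<phi>(1)] MH[OF \<phi>(1)], of j i] by (simp add: pq)
  qed
  moreover have "h2_inner (?ph i) g = 0" if "i < n" "g \<in> zthetaH2 n t" for i g
    using orthN[OF that] that by (simp add: pq)
  moreover have "S (?ph j) \<in> span_plus ?ph {Suc j..<n} (zthetaH2 n t)" if "Suc j < n" for j
    using span[of "Suc j" "S (\<phi> j)"] that inv[OF \<phi>(1)] S_layer[OF \<phi>(2)] unfolding t(2)[symmetric] by (simp add: pq)
  \<comment> \<open>For i = n - 1 the power of \<open>S\<close> in \<open>pS\<close> is the
    first.\<close>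
  moreover have "S (?ph (n - 1)) = zshift n (cprod (coeff (p (n - 1))) t)"
    using pS[of "n - 1"] n by (simp add: pq)
  ultimately show ?thesis using wandering_unit.inner_fn[OF t(1)]
    by (intro exI[of _ t] exI[of _ p] exI[of _ q]) auto
qed

text \<open>By linearity it is enough to treat the finitely many generators and the summand z^n t
  H^2. On the latter \<open>S\<close> is multiplication by z, which can be moved onto the factor
  \<open>h\<close>.\<close>

lemma form_imp_invariant:
  assumes M: "closed_subspace M" and n: "n \<ge> 1"
    and span: "M = span_plus ph {..<n} (zthetaH2 n t)"
    and step: "\<And>j. Suc j < n \<Longrightarrow> S (ph j) \<in> span_plus ph {Suc j..<n} (zthetaH2 n t)"
    and last: "S (ph (n - 1)) = zshift n (cprod (coeff p) t)"
    and a: "a \<in> M"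
  shows "S a \<in> M"
proof -
  let ?G = "zthetaH2 n t"
  have "(\<lambda>_. 0) = zshift n (cprod t (\<lambda>_. 0))" by (auto simp: zshift_def cprod_def)
  hence zG: "(\<lambda>_. 0) \<in> ?G" using H2_zero unfolding zthetaH2_def by blast
  have ph: "ph i \<in> M" if "i < n" for i
  proof -
    have "ph i = (\<lambda>k. (\<Sum>j<n. (if j = i then 1 else 0) * ph j k) + 0)"
      using that by (auto simp: fun_eq_iff if_distrib[of "\<lambda>x. x * _"] cong: if_cong)
    thus ?thesis unfolding span span_plus_def using zG
      by (intro CollectI exI[of _ "\<lambda>j. if j = i then 1 else 0"] exI[of _ "\<lambda>_. 0"]) auto
  qed
  have GM: "?G \<subseteq> M"
  proof
    fix g assume "g \<in> ?G"
    thus "g \<in> M" unfolding span span_plus_def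
      by (intro CollectI exI[of _ "\<lambda>_. 0"] exI[of _ g]) auto
  qed
  have SG: "S g \<in> ?G" if g: "g \<in> ?G" for g
  proof -
    obtain h where h: "h \<in> H2" "g = zshift n (cprod t h)" using g by (auto simp: zthetaH2_def)
    \<comment> \<open>Square-summability of the product is read off from its membership in
      \<open>M\<close>, with no appeal to boundedness of \<open>t\<close>.\<close>
    have "g \<in> zH2 n" using closed_subspace_H2[OF M] GM g h(2) by (auto simp: zH2_def zshift_less)
    hence "S g = zshift 1 (zshift n (cprod t h))" by (simp add: S_high Mz_eq_zshift h(2))
    also have "\<dots> = zshift n (cprod t (zshift 1 h))"
      by (simp add: zshift_zshift cprod_zshift_right)
    finally show ?thesis using h(1) unfolding zthetaH2_def by (auto simp: zshift_H2_iff)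
  qed
  have Sph: "S (ph i) \<in> M" if "i < n" for i
  proof (cases "Suc i < n")
    case True
    have "span_plus ph {Suc i..<n} ?G \<subseteq> M" by (intro span_plus_subset M GM) (auto intro: ph)
    thus ?thesis using step[OF True] by blast
  next
    case False
    hence "i = n - 1" using that by simp
    hence "S (ph i) = zshift n (cprod t (coeff p))" using last cprod_commute by metis
    hence "S (ph i) \<in> ?G" using H2_coeff unfolding zthetaH2_def by blast
    thus ?thesis using GM by blast
  qed
  obtain c g where cg: "a = (\<lambda>k. (\<Sum>i<n. c i * ph i k) + 1 * g k)" "g \<in> ?G"
    using a unfolding span span_plus_def by auto
  have phH: "ph i \<in> H2" if "i < n" for i using closed_subspace_H2[OF M ph[OF that]] .
  have "S a = (\<lambda>k. S (\<lambda>k. \<Sum>i<n. c i * ph i k) k + 1 * S g k)"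
    unfolding cg(1) using closed_subspace_H2[OF M] GM cg(2) phH
    by (intro bounded_op_linear[OF S_op] H2_sum) auto
  also have "S (\<lambda>k. \<Sum>i<n. c i * ph i k) = (\<lambda>k. \<Sum>i<n. c i * S (ph i) k)"
    using phH by (intro bounded_op_sum S_op) auto
  also have "(\<lambda>k. (\<Sum>i<n. c i * S (ph i) k) + 1 * S g k) \<in> M"
    using Sph SG[OF cg(2)] GM by (intro closed_subspace_add_scale closed_subspace_sum M) auto
  finally show ?thesis .
qed

end

theorem theorem3p2:
  fixes n :: nat and F :: "seq \<Rightarrow> seq" and M :: "seq set"
  assumes "n \<ge> 1"
    and "n_perturbation n F"
    and "closed_subspace M"
    and "M \<noteq> {\<lambda>_. 0}"
  shows "(\<forall>a\<in>M. Sop F a \<in> M) \<longleftrightarrow>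
    (\<exists>t :: seq. \<exists>p q :: nat \<Rightarrow> complex poly.
       inner_fn t \<and>
       (\<forall>i<n. \<forall>j<n. i \<noteq> j \<longrightarrow> h2_inner (phi t (p i) (q i) i) (phi t (p j) (q j) j) = 0) \<and>
       (\<forall>i<n. \<forall>g\<in>zthetaH2 n t. h2_inner (phi t (p i) (q i) i) g = 0) \<and>
       M = span_plus (\<lambda>i. phi t (p i) (q i) i) {..<n} (zthetaH2 n t) \<and>
       (\<forall>j. Suc j < n \<longrightarrow>
          Sop F (phi t (p j) (q j) j) \<in> span_plus (\<lambda>i. phi t (p i) (q i) i) {Suc j..<n} (zthetaH2 n t)) \<and>
       Sop F (phi t (p (n - 1)) (q (n - 1)) (n - 1)) = zshift n (cprod (coeff (p (n - 1))) t))"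
    (is "?inv \<longleftrightarrow> ?form")
proof -
  interpret perturbed_shift n F by unfold_locales (rule assms(2))
  show ?thesis
  proof
    assume ?inv
    thus ?form using assms by (intro invariant_imp_form) auto
  next
    assume ?form
    then obtain t p q where
      span: "M = span_plus (\<lambda>i. phi t (p i) (q i) i) {..<n} (zthetaH2 n t)"
      and step: "\<forall>j. Suc j < n \<longrightarrow>
          S (phi t (p j) (q j) j) \<in> span_plus (\<lambda>i. phi t (p i) (q i) i) {Suc j..<n} (zthetaH2 n t)"
      and last: "S (phi t (p (n - 1)) (q (n - 1)) (n - 1)) = zshift n (cprod (coeff (p (n - 1))) t)"
      by blast
    show ?inv
      using form_imp_invariant[OF assms(3,1) span _ last] step by blast
  qed
qed

end
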